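(* The polynomials $Q_n$ satisfy the following three-term recurrence relation of order $p+1$: $$zQ_n(z)=Q_{n+1}(z)+a_nQ_{n-p}(z),\qquad n\ge p,\qquad a_n\in\mathbb{R},$$ where $Q_\ell(z)=z^\ell$ for $\ell=0,\ldots,p$.
   Context: Fix an integer $p\ge 1$. For $0\le j\le p-1$ let $a_j<b_j$ be real numbers (interval endpoints, not to be confused with the recurrence coefficients $a_n$, $n\ge p$) with $0\le a_j<b_j$ if $j$ is even and $a_j<b_j\le 0$ if $j$ is odd, and let $\Gamma_j=\{z\in\mathbb{C}: z^{p+1}\in[a_j,b_j]\}$. Assume $\Gamma_j\cap\Gamma_{j+1}=\emptyset$ for $0\le j\le p-2$. For each $j$ let $\sigma_j$ be a positive finite Borel measure on $\Gamma_j$, invariant under rotation by the angle $2\pi/(p+1)$, with infinitely many points in its support. Set $s_{k,k}=\sigma_k$ and, for $0\le k<j\le p-1$, $ds_{k,j}(z)=\Big(\int_{\Gamma_{k+1}}\frac{ds_{k+1,j}(t)}{z-t}\Big)d\sigma_k(z)$ on $\Gamma_k$; put $s_j=s_{0,j}$ (the Nikishin system generated by $\sigma_0,\ldots,\sigma_{p-1}$). $Q_n$ ($n\ge0$) is the monic polynomial of lowest degree satisfying $\int_{\Gamma_0}Q_n(z)z^l\,ds_j(z)=0$ for $l=0,\ldots,\lfloor\frac{n-j-1}{p}\rfloor$, $0\le j\le p-1$. *)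

theory Defs
  imports "HOL-Analysis.Analysis" "HOL-Computational_Algebra.Polynomial"
begin

definition star :: "nat \<Rightarrow> real \<Rightarrow> real \<Rightarrow> complex set" where
  "star p c d = {z. z ^ (p + 1) \<in> complex_of_real ` {c..d}}"

definition measure_support :: "complex measure \<Rightarrow> complex set" where
  "measure_support M = {z. \<forall>U. open U \<and> z \<in> U \<longrightarrow> emeasure M U > 0}"

text \<open>
  The measures \<open>s\<^sub>k\<^sub>,\<^sub>j\<close> are complex measures, given here by their densities with respect to
  \<open>\<sigma>\<^sub>k\<close>: the density of \<open>s\<^sub>k\<^sub>,\<^sub>k\<close> is \<open>1\<close>, and for \<open>k < j\<close> the density of \<open>s\<^sub>k\<^sub>,\<^sub>j\<close> at \<open>z\<close> is
  the integral of \<open>1 / (z - t)\<close> over \<open>\<Gamma>\<^sub>k\<^sub>+\<^sub>1\<close> with respect to \<open>s\<^sub>k\<^sub>+\<^sub>1\<^sub>,\<^sub>j\<close>.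
  Only indices \<open>k \<le> j\<close> are meaningful.
\<close>
function nikishin_density ::
  "(nat \<Rightarrow> complex set) \<Rightarrow> (nat \<Rightarrow> complex measure) \<Rightarrow> nat \<Rightarrow> nat \<Rightarrow> complex \<Rightarrow> complex" where
  "nikishin_density \<Gamma> \<sigma> k j z =
     (if k < j
      then LINT t : \<Gamma> (k + 1) | \<sigma> (k + 1). 1 / (z - t) * nikishin_density \<Gamma> \<sigma> (k + 1) j t
      else 1)"
  by auto
termination
  by (relation "Wellfounded.measure (\<lambda>(\<Gamma>, \<sigma>, k, j, z). j - k)") auto

declare nikishin_density.simps [simp del]

text \<open>The integral of \<open>f\<close> over \<open>\<Gamma>\<^sub>k\<close> with respect to \<open>s\<^sub>k\<^sub>,\<^sub>j\<close>.\<close>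
definition nikishin_integral ::
  "(nat \<Rightarrow> complex set) \<Rightarrow> (nat \<Rightarrow> complex measure) \<Rightarrow> nat \<Rightarrow> nat \<Rightarrow> (complex \<Rightarrow> complex) \<Rightarrow> complex"
  where
  "nikishin_integral \<Gamma> \<sigma> k j f = (LINT z : \<Gamma> k | \<sigma> k. f z * nikishin_density \<Gamma> \<sigma> k j z)"

text \<open>
  Integer division rounds towards minus infinity, so the bound on \<open>l\<close> is the floor of
  \<open>(n - j - 1) / p\<close>; it is \<open>-1\<close> (no condition) when \<open>n \<le> j < p\<close>.
\<close>
definition multi_orthogonal ::
  "nat \<Rightarrow> (nat \<Rightarrow> complex set) \<Rightarrow> (nat \<Rightarrow> complex measure) \<Rightarrow> nat \<Rightarrow> complex poly \<Rightarrow> bool" where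
  "multi_orthogonal p \<Gamma> \<sigma> n q \<longleftrightarrow>
     (\<forall>j<p. \<forall>l::nat. int l \<le> (int n - int j - 1) div int p \<longrightarrow>
        nikishin_integral \<Gamma> \<sigma> 0 j (\<lambda>z. poly q z * z ^ l) = 0)"

definition multi_orthogonal_poly ::
  "nat \<Rightarrow> (nat \<Rightarrow> complex set) \<Rightarrow> (nat \<Rightarrow> complex measure) \<Rightarrow> nat \<Rightarrow> complex poly" where
  "multi_orthogonal_poly p \<Gamma> \<sigma> n =
     (THE q. lead_coeff q = 1 \<and> multi_orthogonal p \<Gamma> \<sigma> n q \<and>
        (\<forall>r. lead_coeff r = 1 \<and> multi_orthogonal p \<Gamma> \<sigma> n r \<longrightarrow> degree q \<le> degree r))"

end

theory Submission
  imports Defs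
begin

text \<open>
  The measures are invariant under the rotation of order \<open>p + 1\<close>, so \<open>z\<^sup>m\<close> has nonzero integral
  against \<open>s\<^sub>j\<close> only if \<open>m \<equiv> j\<close> modulo \<open>p + 1\<close>; in the variable \<open>x = z\<^bsup>p+1\<^esup>\<close> the orthogonality
  conditions become real ones, for a Nikishin system on intervals. Number the conditions by
  \<open>m = l p + j\<close>, so that \<open>Q\<^sub>n\<close> is subject to the conditions \<open>m < n\<close> and multiplication by \<open>z\<close> shifts
  the index by \<open>p\<close>. Condition \<open>m\<close> only involves the coefficients of index congruent to \<open>m\<close> modulo
  \<open>p + 1\<close>.

  The main point is that a nonzero polynomial of degree less than \<open>n\<close> violates one of the conditions
  \<open>m < n\<close>. For one residue class this says that a square moment matrix is invertible. A vector in its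
  left kernel is a combination of the weights orthogonal to all small powers of \<open>x\<close>, which
  therefore has too many zeros. Such zeros descend to the next level of the system: dividing by the
  polynomial with these zeros and expanding in partial fractions gives orthogonality relations for
  the function whose Cauchy transform occurs, hence many zeros for it too, until only a polynomial
  is left.

  Then \<open>Q\<^sub>n\<close> has degree \<open>n\<close>, real coefficients, and only powers congruent to \<open>n\<close>. With \<open>a\<^sub>n\<close> chosen
  such that condition \<open>n - p\<close> holds, \<open>z Q\<^sub>n - Q\<^sub>n\<^sub>+\<^sub>1 - a\<^sub>n Q\<^sub>n\<^sub>-\<^sub>p\<close> has degree at most \<open>n\<close> and satisfies
  the conditions \<open>m \<le> n\<close>: those with \<open>n - p < m\<close> hold because of the residues. So it vanishes.
\<close>

section \<open>Linear systems and partial fractions\<close>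

text \<open>Gaussian elimination: each equation is spent on one unknown, and an unknown is left over
  at the end.\<close>

lemma underdetermined_system:
  fixes A :: "'t \<Rightarrow> 's \<Rightarrow> 'a::field"
  assumes "finite T" "finite S" "card T < card S"
  shows "\<exists>c. (\<exists>s\<in>S. c s \<noteq> 0) \<and> (\<forall>t\<in>T. (\<Sum>s\<in>S. A t s * c s) = 0)"
  using assms
proof (induction T arbitrary: S A rule: finite_induct)
  case empty
  then have "S \<noteq> {}" by auto
  then show ?case by (intro exI[of _ "\<lambda>_. 1"]) auto
next
  case (insert t T)
  show ?case
  proof (cases "\<forall>s\<in>S. A t s = 0")
    case True
    have "card T < card S" using insert by simp
    from insert.IH[OF insert.prems(1) this, of A] obtain c
      where "\<exists>s\<in>S. c s \<noteq> 0" "\<forall>t\<in>T. (\<Sum>s\<in>S. A t s * c s) = 0" by blast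
    then show ?thesis using True by (intro exI[of _ c]) auto
  next
    case False
    then obtain s0 where s0: "s0 \<in> S" "A t s0 \<noteq> 0" by blast
    let ?S = "S - {s0}"
    \<comment> \<open>\<open>?B\<close> is what remains of the other equations once
      \<open>t\<close>, with pivot \<open>A t s0\<close>, has eliminated the unknown
      \<open>s0\<close>; afterwards \<open>e s0\<close> takes the value that equation
      \<open>t\<close> forces.\<close>
    let ?B = "\<lambda>u s. A u s - A u s0 * A t s / A t s0"
    have "card T < card ?S" using insert s0 by simp
    from insert.IH[OF _ this, of ?B] insert.prems(1) obtain c
      where c: "\<exists>s\<in>?S. c s \<noteq> 0" "\<forall>u\<in>T. (\<Sum>s\<in>?S. ?B u s * c s) = 0" by auto
    define e where "e = c(s0 := - (\<Sum>s\<in>?S. A t s * c s) / A t s0)"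
    have split: "(\<Sum>s\<in>S. A u s * e s) = A u s0 * e s0 + (\<Sum>s\<in>?S. A u s * c s)" for u
    proof -
      have "(\<Sum>s\<in>S. A u s * e s) = A u s0 * e s0 + (\<Sum>s\<in>?S. A u s * e s)"
        using s0 insert.prems(1) by (simp add: sum.remove)
      also have "(\<Sum>s\<in>?S. A u s * e s) = (\<Sum>s\<in>?S. A u s * c s)"
        by (rule sum.cong) (auto simp: e_def)
      finally show ?thesis .
    qed
    have "(\<Sum>s\<in>S. A t s * e s) = 0"
      unfolding split using s0 by (simp add: e_def)
    moreover have "(\<Sum>s\<in>S. A u s * e s) = 0" if "u \<in> T" for u
    proof -
      have "(\<Sum>s\<in>?S. ?B u s * c s) =
          (\<Sum>s\<in>?S. A u s * c s) - A u s0 / A t s0 * (\<Sum>s\<in>?S. A t s * c s)"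
        by (simp add: sum_subtractf sum_distrib_left algebra_simps)
      then show ?thesis unfolding split using c that by (simp add: e_def)
    qed
    moreover have "\<exists>s\<in>S. e s \<noteq> 0" using c(1) by (auto simp: e_def)
    ultimately show ?thesis by (intro exI[of _ e]) auto
  qed
qed

text \<open>If \<open>c s0\<close> is nonzero, dropping column \<open>s0\<close> leaves fewer
  equations than unknowns for a left kernel vector \<open>e\<close>. Pairing \<open>e\<close> with
  \<open>c\<close> then shows that \<open>e\<close> also kills column \<open>s0\<close>.\<close>

lemma trivial_kernel_transpose:
  fixes A :: "nat \<Rightarrow> nat \<Rightarrow> 'a::field"
  assumes left: "\<And>e. \<forall>s<d. (\<Sum>t<d. e t * A t s) = 0 \<Longrightarrow> \<forall>t<d. e t = 0"
    and right: "\<forall>t<d. (\<Sum>s<d. A t s * c s) = 0"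
  shows "\<forall>s<d. c s = 0"
proof (rule ccontr)
  assume "\<not> ?thesis"
  then obtain s0 where s0: "s0 < d" "c s0 \<noteq> 0" by auto
  have "card ({..<d} - {s0}) < card {..<d}" using s0 by simp
  from underdetermined_system[OF _ _ this, of "\<lambda>s t. A t s"] obtain e
    where e: "\<exists>t<d. e t \<noteq> 0" "\<forall>s\<in>{..<d}-{s0}. (\<Sum>t<d. A t s * e t) = 0" by auto
  have "0 = (\<Sum>t<d. e t * (\<Sum>s<d. A t s * c s))" using right by simp
  also have "\<dots> = (\<Sum>s<d. c s * (\<Sum>t<d. A t s * e t))"
    unfolding sum_distrib_left by (subst sum.swap) (simp add: mult_ac)
  also have "\<dots> = c s0 * (\<Sum>t<d. A t s0 * e t)"
    using s0 e(2) by (simp add: sum.remove[of "{..<d}" s0])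
  finally have "(\<Sum>t<d. A t s0 * e t) = 0" using s0 by simp
  then have "\<forall>s<d. (\<Sum>t<d. e t * A t s) = 0" using e(2) by (force simp: mult.commute)
  then show False using left e(1) by blast
qed

section \<open>Interpolation and partial fractions at finitely many nodes\<close>

lemma poly_eq_0_of_card_roots:
  fixes q :: "'a::idom poly"
  assumes "finite Z" "\<And>x. x \<in> Z \<Longrightarrow> poly q x = 0" "degree q < card Z"
  shows "q = 0"
proof (rule ccontr)
  assume q: "q \<noteq> 0"
  have "card Z \<le> card {x. poly q x = 0}"
    using assms by (intro card_mono poly_roots_finite[OF q]) auto
  also have "\<dots> \<le> degree q" by (rule card_poly_roots_bound[OF q])
  finally show False using assms(3) by simp
qed

text \<open>The difference \<open>R\<close> of \<open>P\<close> and its Lagrange interpolant on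
  \<open>Z\<close> has degree below \<open>card Z\<close> and vanishes on \<open>Z\<close>, so it is
  zero. The expansion is the interpolation formula divided by the nodal polynomial.\<close>

lemma lagrange_partial_fractions:
  fixes P :: "'a::field poly"
  assumes Z: "finite Z" and deg: "degree P < card Z" and y: "y \<notin> Z"
  shows "poly P y / (\<Prod>x\<in>Z. y - x) =
    (\<Sum>x\<in>Z. poly P x / ((\<Prod>u\<in>Z-{x}. x - u) * (y - x)))"
proof -
  define l where "l = (\<lambda>x. \<Prod>u\<in>Z-{x}. [:- u, 1:])"
  define c where "c = (\<lambda>x. poly P x / (\<Prod>u\<in>Z-{x}. x - u))"
  define R where "R = P - (\<Sum>x\<in>Z. smult (c x) (l x))"
  have pl: "poly (l x) v = (\<Prod>u\<in>Z-{x}. v - u)" for x v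
    by (simp add: l_def poly_prod)
  have "degree (l x) < card Z" if "x \<in> Z" for x
  proof -
    have "degree (l x) \<le> (\<Sum>u\<in>Z-{x}. degree [:- u, 1:])"
      unfolding l_def using degree_prod_sum_le[of "Z - {x}" "\<lambda>u. [:- u, 1:]"] Z by (simp add: comp_def)
    also have "\<dots> = card (Z - {x})" by simp
    also have "\<dots> < card Z" using that Z by (meson card_Diff1_less)
    finally show ?thesis .
  qed
  then have "degree (smult (c x) (l x)) < card Z" if "x \<in> Z" for x
    using that by (meson degree_smult_le le_less_trans)
  then have "degree (\<Sum>x\<in>Z. smult (c x) (l x)) < card Z"
    using deg by (intro degree_sum_less) auto
  then have degR: "degree R < card Z"
    unfolding R_def using deg by (intro degree_diff_less)
  have "poly R v = 0" if v: "v \<in> Z" for v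
  proof -
    have "poly (\<Sum>x\<in>Z. smult (c x) (l x)) v = (\<Sum>x\<in>Z. c x * (\<Prod>u\<in>Z-{x}. v - u))"
      by (simp add: poly_sum pl)
    also have "\<dots> = c v * (\<Prod>u\<in>Z-{v}. v - u) +
        (\<Sum>x\<in>Z-{v}. c x * (\<Prod>u\<in>Z-{x}. v - u))"
      using v Z by (simp add: sum.remove)
    also have "(\<Sum>x\<in>Z-{v}. c x * (\<Prod>u\<in>Z-{x}. v - u)) = 0"
      using v Z by (intro sum.neutral ballI mult_not_zero) (auto intro!: prod_zero)
    also have "c v * (\<Prod>u\<in>Z-{v}. v - u) = poly P v"
      using Z by (auto simp: c_def prod_zero_iff)
    finally show ?thesis by (simp add: R_def)
  qed
  then have "R = 0" using Z degR by (intro poly_eq_0_of_card_roots) auto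
  then have Py: "poly P y = (\<Sum>x\<in>Z. c x * (\<Prod>u\<in>Z-{x}. y - u))"
    by (simp add: R_def poly_sum pl)
  have "(\<Prod>x\<in>Z. y - x) = (y - x) * (\<Prod>u\<in>Z-{x}. y - u)" if "x \<in> Z" for x
    using that Z by (simp add: prod.remove)
  moreover have "(\<Prod>u\<in>Z-{x}. y - u) \<noteq> 0" for x
    using y Z by (auto simp: prod_zero_iff)
  ultimately have "c x * (\<Prod>u\<in>Z-{x}. y - u) / (\<Prod>x\<in>Z. y - x) =
      poly P x / ((\<Prod>u\<in>Z-{x}. x - u) * (y - x))" if "x \<in> Z" for x
    using that by (simp add: c_def)
  with Py show ?thesis by (simp add: sum_divide_distrib)
qed

text \<open>The sum is the coefficient of \<open>1 / y\<close> at infinity of \<open>P\<close> over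
  the nodal polynomial, and the degrees differ by at least two. The algebraic version expands
  \<open>P * [:- c, 1:]\<close> at the point \<open>c\<close>, where it vanishes.\<close>

lemma lagrange_sum_eq_0:
  fixes P :: "real poly"
  assumes Z: "finite Z" and deg: "degree P + 1 < card Z"
  shows "(\<Sum>x\<in>Z. poly P x / (\<Prod>u\<in>Z-{x}. x - u)) = 0"
proof -
  obtain c where c: "c \<notin> Z" using ex_new_if_finite[OF infinite_UNIV_char_0 Z] by blast
  have "degree (P * [:- c, 1:]) \<le> degree P + degree [:- c, 1:]" by (rule degree_mult_le)
  then have "degree (P * [:- c, 1:]) < card Z" using deg by simp
  from lagrange_partial_fractions[OF Z this c]
  have "(\<Sum>x\<in>Z. poly P x * (x - c) / ((\<Prod>u\<in>Z-{x}. x - u) * (c - x))) = 0" by (simp add: algebra_simps)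
  moreover have "poly P x * (x - c) / ((\<Prod>u\<in>Z-{x}. x - u) * (c - x)) =
      - (poly P x / (\<Prod>u\<in>Z-{x}. x - u))" if "x \<in> Z" for x
  proof -
    have "c - x \<noteq> 0" using that c by auto
    then have "poly P x * (x - c) / (w * (c - x)) = - (poly P x / w)" for w
      by (simp add: divide_simps) (simp add: algebra_simps)
    then show ?thesis by blast
  qed
  ultimately show ?thesis by (simp add: sum_negf)
qed

section \<open>Sign changes of orthogonal functions\<close>

text \<open>The sign at the midpoint spreads over the open interval by the intermediate value
  theorem and reaches the end points, where zeros are allowed, by continuity.\<close>

lemma sign_without_zeros:
  fixes g :: "real \<Rightarrow> real"
  assumes "a < b" "continuous_on {a..b} g" "\<And>x. x \<in> {a<..<b} \<Longrightarrow> g x \<noteq> 0"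
  shows "\<exists>c\<in>{1, -1::real}. \<forall>x\<in>{a..b}. 0 \<le> c * g x"
proof -
  define m where "m = (a + b) / 2"
  define c where "c = sgn (g m)"
  have m: "m \<in> {a<..<b}" using assms(1) by (simp add: m_def)
  have c: "c \<in> {1, -1}" using assms(3)[OF m] by (auto simp: c_def sgn_if)
  have cont: "continuous_on {a..b} (\<lambda>x. c * g x)" by (intro continuous_intros assms(2))
  have pos: "0 < c * g m" using assms(3)[OF m] by (auto simp: c_def sgn_if)
  have "0 \<le> c * g x" if x: "x \<in> {a<..<b}" for x
  proof (rule ccontr)
    assume neg: "\<not> 0 \<le> c * g x"
    have conn: "connected ((\<lambda>x. c * g x) ` {a<..<b})"
      by (intro connected_continuous_image continuous_on_subset[OF cont]) auto
    have "0 \<in> (\<lambda>x. c * g x) ` {a<..<b}"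
      by (rule connectedD_interval[OF conn, of "c * g x" "c * g m"]) (use x m neg pos in auto)
    then show False using assms(3) c by auto
  qed
  then have "0 \<le> c * g x" if "x \<in> {a..b}" for x
    using continuous_ge_on_closure[of "{a<..<b}" "\<lambda>x. c * g x" x 0] cont that assms(1) by auto
  then show ?thesis using c by blast
qed

text \<open>\<open>S\<close> collects the zeros where \<open>g\<close> changes sign. The induction
  moves the right end to the largest zero \<open>m\<close>, which joins \<open>S\<close> exactly
  when the signs obtained on its two sides differ.\<close>

lemma sign_change_product:
  fixes g :: "real \<Rightarrow> real"
  assumes "a < b" "continuous_on {a..b} g" "finite {x\<in>{a<..<b}. g x = 0}"
  shows "\<exists>S c. S \<subseteq> {x\<in>{a<..<b}. g x = 0} \<and> c \<in> {1, -1} \<and>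
    (\<forall>x\<in>{a..b}. 0 \<le> c * ((\<Prod>s\<in>S. x - s) * g x))"
  using assms
proof (induction "card {x\<in>{a<..<b}. g x = 0}" arbitrary: b rule: less_induct)
  case (less b)
  let ?Z = "{x\<in>{a<..<b}. g x = 0}"
  show ?case
  proof (cases "?Z = {}")
    case True
    then have "\<And>x. x \<in> {a<..<b} \<Longrightarrow> g x \<noteq> 0" by auto
    with less.prems(1,2) obtain c :: real
      where "c \<in> {1, -1}" "\<forall>x\<in>{a..b}. 0 \<le> c * g x"
      using sign_without_zeros by blast
    then show ?thesis by (intro exI[of _ "{}"] exI[of _ c]) simp
  next
    case False
    define m where "m = Max ?Z"
    have mZ: "m \<in> ?Z" unfolding m_def using less.prems(3) False by (rule Max_in)
    have gm: "g x \<noteq> 0" if "x \<in> {m<..<b}" for x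
      using Max_ge[OF less.prems(3), of x] that mZ unfolding m_def[symmetric] by auto
    have sub: "{x\<in>{a<..<m}. g x = 0} \<subset> ?Z" using mZ by auto
    have "card {x\<in>{a<..<m}. g x = 0} < card ?Z"
      using sub less.prems(3) by (rule psubset_card_mono[rotated])
    moreover have "a < m" using mZ by auto
    moreover have "continuous_on {a..m} g"
      by (rule continuous_on_subset[OF less.prems(2)]) (use mZ in auto)
    moreover have "finite {x\<in>{a<..<m}. g x = 0}"
      using sub less.prems(3) by (meson finite_subset psubset_imp_subset)
    ultimately obtain S c where S: "S \<subseteq> {x\<in>{a<..<m}. g x = 0}" "c \<in> {1, -1}"
      "\<forall>x\<in>{a..m}. 0 \<le> c * ((\<Prod>s\<in>S. x - s) * g x)"
      using less.hyps[of m] by blast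
    have "m < b" using mZ by auto
    moreover have "continuous_on {m..b} g"
      by (rule continuous_on_subset[OF less.prems(2)]) (use mZ in auto)
    ultimately have "\<exists>c\<in>{1, -1::real}. \<forall>x\<in>{m..b}. 0 \<le> c * g x"
      using gm by (rule sign_without_zeros)
    then obtain c' where c': "c' \<in> {1, -1}" "\<And>x. x \<in> {m..b} \<Longrightarrow> 0 \<le> c' * g x"
      by (elim bexE) (rule that, auto)
    have finS: "finite S" using S(1) sub less.prems(3) by (meson finite_subset psubset_imp_subset)
    have mS: "m \<notin> S" using S(1) by auto
    \<comment> \<open>\<open>S\<close> lies to the left of \<open>m\<close>, so its product does not
      affect the sign on \<open>{m..b}\<close>.\<close>
    have right: "0 \<le> c' * ((\<Prod>s\<in>S. x - s) * g x)" if "x \<in> {m..b}" for x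
    proof -
      have "0 \<le> (\<Prod>s\<in>S. x - s)" using S(1) that by (intro prod_nonneg) auto
      then have "0 \<le> (\<Prod>s\<in>S. x - s) * (c' * g x)" using c'(2)[OF that] by simp
      then show ?thesis by (simp add: mult_ac)
    qed
    show ?thesis
    proof (cases "c' = c")
      case True
      have "\<forall>x\<in>{a..b}. 0 \<le> c * ((\<Prod>s\<in>S. x - s) * g x)"
      proof
        fix x assume "x \<in> {a..b}"
        then show "0 \<le> c * ((\<Prod>s\<in>S. x - s) * g x)"
          using S(3) right[of x] True by (cases "x \<le> m") auto
      qed
      then show ?thesis using S sub by blast
    next
      case False
      then have cc: "c = - c'" using S(2) c'(1) by auto
      have "\<forall>x\<in>{a..b}. 0 \<le> c' * ((\<Prod>s\<in>insert m S. x - s) * g x)"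
      proof
        fix x assume x: "x \<in> {a..b}"
        have eq: "c' * ((\<Prod>s\<in>insert m S. x - s) * g x) =
            (x - m) * (c' * ((\<Prod>s\<in>S. x - s) * g x))"
          using finS mS by (simp add: mult_ac)
        show "0 \<le> c' * ((\<Prod>s\<in>insert m S. x - s) * g x)"
        proof (cases "x \<le> m")
          case True
          then have "c' * ((\<Prod>s\<in>S. x - s) * g x) \<le> 0" using S(3) x cc by force
          then show ?thesis unfolding eq using True by (intro mult_nonpos_nonpos) auto
        next
          case False
          then show ?thesis unfolding eq using right[of x] x by (intro mult_nonneg_nonneg[of "x - m"]) auto
        qed
      qed
      moreover have "insert m S \<subseteq> ?Z" using S(1) sub mZ by auto
      ultimately show ?thesis using c'(1) by blast
    qed
  qed
qed

lemma set_integrable_continuous_compact: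
  fixes f :: "'a::t2_space \<Rightarrow> 'b::{banach, second_countable_topology}"
  assumes "finite_measure M" "sets M = sets borel" "compact S" "continuous_on S f"
  shows "set_integrable M S f"
proof -
  interpret finite_measure M by fact
  have "bounded (f ` S)" using assms by (intro compact_imp_bounded compact_continuous_image)
  then obtain B where B: "\<And>x. x \<in> S \<Longrightarrow> norm (f x) \<le> B" unfolding bounded_iff by auto
  have S: "S \<in> sets borel" by (simp add: borel_compact assms(3))
  have "(\<lambda>x. indicator S x *\<^sub>R f x) \<in> borel_measurable borel"
    using borel_measurable_continuous_on_indicator[OF S assms(4)] .
  then have "(\<lambda>x. indicator S x *\<^sub>R f x) \<in> borel_measurable M"
    by (simp cong: measurable_cong_sets add: assms(2))
  then show ?thesis
    unfolding set_integrable_def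
    by (rule integrable_const_bound[of _ "max B 0", rotated])
       (auto simp: indicator_def le_max_iff_disj B)
qed

text \<open>With fewer than \<open>n\<close> zeros, the polynomial \<open>v\<close> whose roots are
  the sign changes of \<open>g\<close> is an admissible test polynomial. Then \<open>v * g\<close>
  has constant sign and zero integral, so the measure on the interval sits on a finite set.
  Finiteness of the zero set is assumed because \<open>card\<close> is \<open>0\<close> on infinite
  sets.\<close>

lemma orthogonal_imp_many_zeros:
  fixes g :: "real \<Rightarrow> real"
  assumes M: "finite_measure M" "sets M = sets borel"
    and supp: "\<And>F. finite F \<Longrightarrow> \<not> (AE x in M. x \<in> {a..b} \<longrightarrow> x \<in> F)"
    and "a < b" and cont: "continuous_on {a..b} g"
    and orth: "\<And>v. degree v < n \<Longrightarrow> (LINT x:{a..b}|M. poly v x * g x) = 0"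
    and fin: "finite {x\<in>{a<..<b}. g x = 0}"
  shows "n \<le> card {x\<in>{a<..<b}. g x = 0}"
proof (rule ccontr)
  let ?Z = "{x\<in>{a<..<b}. g x = 0}"
  assume "\<not> n \<le> card ?Z"
  obtain S c where S: "S \<subseteq> ?Z" "c \<in> {1, -1}"
      "\<forall>x\<in>{a..b}. 0 \<le> c * ((\<Prod>s\<in>S. x - s) * g x)"
    using sign_change_product[OF \<open>a < b\<close> cont fin] by blast
  have finS: "finite S" using S(1) fin finite_subset by blast
  define v where "v = smult c (\<Prod>s\<in>S. [:- s, 1:])"
  have pv: "poly v x = c * (\<Prod>s\<in>S. x - s)" for x by (simp add: v_def poly_prod)
  have "degree v \<le> (\<Sum>s\<in>S. degree [:- s, 1:])"
    unfolding v_def using degree_prod_sum_le[OF finS, of "\<lambda>s. [:- s, 1:]"]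
    by (intro degree_smult_le[THEN order_trans]) (simp add: comp_def)
  also have "\<dots> = card S" by simp
  also have "\<dots> \<le> card ?Z" using S(1) fin by (rule card_mono[rotated])
  finally have "degree v < n" using \<open>\<not> n \<le> card ?Z\<close> by simp
  let ?f = "\<lambda>x. indicator {a..b} x *\<^sub>R (poly v x * g x)"
  have "set_integrable M {a..b} (\<lambda>x. poly v x * g x)"
    using M cont by (intro set_integrable_continuous_compact continuous_intros) auto
  then have int: "integrable M ?f" unfolding set_integrable_def .
  have nonneg: "AE x in M. 0 \<le> ?f x"
    using S(3) by (intro AE_I2) (auto simp: indicator_def pv mult_ac)
  have "integral\<^sup>L M ?f = 0"
    using orth[OF \<open>degree v < n\<close>] unfolding set_lebesgue_integral_def .
  then have "AE x in M. ?f x = 0"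
    using integral_nonneg_eq_0_iff_AE[OF int nonneg] by simp
  \<comment> \<open>The end points are added because \<open>?Z\<close> only lists zeros in the open
    interval.\<close>
  then have "AE x in M. x \<in> {a..b} \<longrightarrow> x \<in> ?Z \<union> {a, b}"
  proof eventually_elim
    case (elim x)
    show ?case
    proof
      assume x: "x \<in> {a..b}"
      then have "poly v x * g x = 0" using elim by simp
      then have "(\<Prod>s\<in>S. x - s) = 0 \<or> g x = 0" using S(2) by (auto simp: pv)
      then show "x \<in> ?Z \<union> {a, b}" using x S(1) finS by (auto simp: prod_zero_iff)
    qed
  qed
  then show False using supp[of "?Z \<union> {a, b}"] fin by simp
qed

section \<open>Nikishin systems on intervals\<close>

text \<open>Dominated convergence: the kernel is bounded by \<open>1 / d\<close>, where
  \<open>d\<close> is a positive lower bound for the distance between the disjoint compact sets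
  \<open>I\<close> and \<open>J\<close>.\<close>

lemma continuous_on_cauchy_transform:
  fixes f :: "real \<Rightarrow> real"
  assumes M: "finite_measure M" "sets M = sets borel"
    and I: "compact I" and J: "compact J" and IJ: "I \<inter> J = {}" and f: "continuous_on J f"
  shows "continuous_on I (\<lambda>x. LINT y:J|M. f y / (x - y))"
proof -
  obtain d where d: "d > 0" "\<And>x y. x \<in> I \<Longrightarrow> y \<in> J \<Longrightarrow> d \<le> dist x y"
    using separate_compact_closed[OF I compact_imp_closed[OF J] IJ] by blast
  have ne: "x - y \<noteq> 0" if "x \<in> I" "y \<in> J" for x y using that IJ by auto
  have int: "set_integrable M J (\<lambda>y. f y / (x - y))" if "x \<in> I" for x
    using ne[OF that] by (intro set_integrable_continuous_compact M J continuous_intros f) auto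
  have intf: "set_integrable M J (\<lambda>y. \<bar>f y\<bar> / d)"
    using d by (intro set_integrable_continuous_compact M J continuous_intros f) auto
  show ?thesis
    unfolding continuous_on_sequentially
  proof (intro allI ballI impI, elim conjE)
    fix u x assume x: "x \<in> I" and u: "\<forall>n. u n \<in> I" "u \<longlonglongrightarrow> x"
    have "(\<lambda>n. \<integral>y. indicator J y *\<^sub>R (f y / (u n - y)) \<partial>M)
        \<longlonglongrightarrow> (\<integral>y. indicator J y *\<^sub>R (f y / (x - y)) \<partial>M)"
    proof (rule integral_dominated_convergence[where w = "\<lambda>y. indicator J y *\<^sub>R (\<bar>f y\<bar> / d)"])
      show "(\<lambda>y. indicator J y *\<^sub>R (f y / (x - y))) \<in> borel_measurable M"
        using int[OF x] unfolding set_integrable_def by auto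
      show "(\<lambda>y. indicator J y *\<^sub>R (f y / (u n - y))) \<in> borel_measurable M" for n
        using int u(1) unfolding set_integrable_def by auto
      show "integrable M (\<lambda>y. indicator J y *\<^sub>R (\<bar>f y\<bar> / d))"
        using intf unfolding set_integrable_def .
      show "AE y in M. (\<lambda>n. indicator J y *\<^sub>R (f y / (u n - y)))
          \<longlonglongrightarrow> indicator J y *\<^sub>R (f y / (x - y))"
      proof (rule AE_I2)
        fix y
        show "(\<lambda>n. indicator J y *\<^sub>R (f y / (u n - y)))
          \<longlonglongrightarrow> indicator J y *\<^sub>R (f y / (x - y))"
          using ne[OF x, of y] u(2) by (cases "y \<in> J") (auto intro!: tendsto_intros)
      qed
      show "AE y in M. norm (indicator J y *\<^sub>R (f y / (u n - y)))
          \<le> indicator J y *\<^sub>R (\<bar>f y\<bar> / d)" for n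
      proof (rule AE_I2)
        fix y
        show "norm (indicator J y *\<^sub>R (f y / (u n - y))) \<le> indicator J y *\<^sub>R (\<bar>f y\<bar> / d)"
        proof (cases "y \<in> J")
          case True
          have "d \<le> \<bar>u n - y\<bar>" using d(2)[of "u n" y] u(1) True by (simp add: dist_real_def)
          then show ?thesis using d(1) True by (auto intro!: divide_left_mono mult_pos_pos)
        qed simp
      qed
    qed
    then show "((\<lambda>x. LINT y:J|M. f y / (x - y)) \<circ> u) \<longlonglongrightarrow> (LINT y:J|M. f y / (x - y))"
      unfolding set_lebesgue_integral_def comp_def .
  qed
qed

text \<open>The counterpart of \<open>nikishin_density\<close> in the variable
  \<open>x = z ^ (p + 1)\<close>; by \<open>nikishin_density_eq\<close> the two differ by a power of
  \<open>z\<close>. The factor \<open>y\<close> is the power \<open>t ^ (p + 1)\<close> that is left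
  under the integral at every level before the last.\<close>

function interval_density ::
  "(nat \<Rightarrow> real set) \<Rightarrow> (nat \<Rightarrow> real measure) \<Rightarrow> nat \<Rightarrow> nat \<Rightarrow> real \<Rightarrow> real" where
  "interval_density I \<tau> k j x =
     (if k < j
      then LINT y : I (k + 1) | \<tau> (k + 1).
        (if k + 1 < j then y else 1) * interval_density I \<tau> (k + 1) j y / (x - y)
      else 1)"
  by auto
termination
  by (relation "Wellfounded.measure (\<lambda>(I, \<tau>, k, j, x). j - k)") auto

declare interval_density.simps [simp del]

text \<open>The hypotheses are those inherited by the image of a star system under
  \<open>z ^ (p + 1)\<close>. Infinite support takes the almost-everywhere form that
  \<open>orthogonal_imp_many_zeros\<close> uses.\<close>

locale interval_nikishin =
  fixes p :: nat and a b :: "nat \<Rightarrow> real" and \<tau> :: "nat \<Rightarrow> real measure"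
  assumes less: "k < p \<Longrightarrow> a k < b k"
    and finite_measure: "k < p \<Longrightarrow> finite_measure (\<tau> k)"
    and sets: "k < p \<Longrightarrow> sets (\<tau> k) = sets borel"
    and not_finitely_supported:
      "k < p \<Longrightarrow> finite F \<Longrightarrow> \<not> (AE x in \<tau> k. x \<in> {a k..b k} \<longrightarrow> x \<in> F)"
    and zero_not_inside: "k < p \<Longrightarrow> 0 \<notin> {a k<..<b k}"
    and disjoint: "k + 1 < p \<Longrightarrow> {a k..b k} \<inter> {a (k + 1)..b (k + 1)} = {}"
begin

abbreviation I :: "nat \<Rightarrow> real set" where "I k \<equiv> {a k..b k}"

abbreviation h :: "nat \<Rightarrow> nat \<Rightarrow> real \<Rightarrow> real" where "h \<equiv> interval_density I \<tau>"

lemma h_self [simp]: "h k k x = 1"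
  by (simp add: interval_density.simps)

lemma h_less: "k < j \<Longrightarrow> h k j x =
    (LINT y:I (k + 1)|\<tau> (k + 1). (if k + 1 < j then y else 1) * h (k + 1) j y / (x - y))"
  by (subst interval_density.simps) simp

lemma continuous_on_h: "k \<le> j \<Longrightarrow> j < p \<Longrightarrow> continuous_on (I k) (h k j)"
proof (induction "j - k" arbitrary: k)
  case 0
  then have "k = j" by simp
  then show ?case by simp
next
  case (Suc n)
  then have kj: "k < j" "k + 1 < p" by auto
  have "continuous_on (I (k + 1)) (h (k + 1) j)" using Suc kj by auto
  then have "continuous_on (I (k + 1)) (\<lambda>y. (if k + 1 < j then y else 1) * h (k + 1) j y)"
    by (cases "k + 1 < j") (auto intro!: continuous_intros)
  note continuous_on_cauchy_transform[OF finite_measure[OF kj(2)] sets[OF kj(2)] _ _ disjoint[OF kj(2)] this]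
  moreover have "h k j = (\<lambda>x. LINT y:I (k + 1)|\<tau> (k + 1).
      (if k + 1 < j then y else 1) * h (k + 1) j y / (x - y))"
    by (rule ext) (rule h_less[OF kj(1)])
  ultimately show ?case by (simp only: compact_Icc)
qed

text \<open>With the exponents \<open>\<epsilon>\<close> below, the function integrated in the Cauchy transform of a
  combination at level \<open>k\<close> is, up to a power of the variable, again a combination at level
  \<open>k + 1\<close>. The parameter \<open>r\<close> is the residue of the degree modulo \<open>p + 1\<close> in the star picture.\<close>

definition \<epsilon> :: "nat \<Rightarrow> nat \<Rightarrow> nat \<Rightarrow> nat" where
  "\<epsilon> r k j = (if k < r \<and> r \<le> j then 0 else 1)"

definition combination :: "nat \<Rightarrow> (nat \<Rightarrow> real poly) \<Rightarrow> nat \<Rightarrow> real \<Rightarrow> real" where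
  "combination r q k x = poly (q k) x + (\<Sum>j\<in>{k<..<p}. x ^ \<epsilon> r k j * poly (q j) x * h k j x)"

text \<open>For \<open>k + 1 < j\<close> the exponents satisfy \<open>\<epsilon> r k j + 1 =
  \<epsilon> r k (k + 1) + \<epsilon> r (k + 1) j\<close>; the extra \<open>1\<close> is the factor
  \<open>y\<close> in the recursion for \<open>h\<close>.\<close>

lemma combination_Suc:
  assumes "k + 1 < p"
  shows "y ^ \<epsilon> r k (k + 1) * combination r q (k + 1) y =
    (\<Sum>j\<in>{k<..<p}. y ^ \<epsilon> r k j * poly (q j) y * ((if k + 1 < j then y else 1) * h (k + 1) j y))"
proof -
  have "{k<..<p} = insert (k + 1) {k+1<..<p}" using assms by auto
  moreover have "y ^ \<epsilon> r k j * poly (q j) y * ((if k + 1 < j then y else 1) * h (k + 1) j y) =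
      y ^ \<epsilon> r k (k + 1) * (y ^ \<epsilon> r (k + 1) j * poly (q j) y * h (k + 1) j y)"
    if "j \<in> {k+1<..<p}" for j
    using that by (auto simp: \<epsilon>_def)
  moreover from this have "(\<Sum>j\<in>{k+1<..<p}. y ^ \<epsilon> r k j * poly (q j) y *
        ((if k + 1 < j then y else 1) * h (k + 1) j y)) =
      (\<Sum>j\<in>{k+1<..<p}. y ^ \<epsilon> r k (k + 1) * (y ^ \<epsilon> r (k + 1) j * poly (q j) y * h (k + 1) j y))"
    by (rule sum.cong[OF refl])
  ultimately show ?thesis
    by (simp add: combination_def distrib_left sum_distrib_left del: Suc_eq_plus1)
qed

lemma continuous_on_combination:
  assumes "k < p" shows "continuous_on (I k) (combination r q k)"
  unfolding combination_def[abs_def]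
  using assms by (intro continuous_intros continuous_on_h) auto

text \<open>Dividing a combination by the polynomial with the same zeros and expanding in partial
  fractions shifts its zeros at level \<open>k\<close> to orthogonality relations at level \<open>k + 1\<close>.\<close>

lemma combination_orthogonal:
  assumes k: "k + 1 < p" and Z: "finite Z" "Z \<subseteq> I k"
    and zero: "\<And>x. x \<in> Z \<Longrightarrow> combination r q k x = 0"
    and deg_k: "q k = 0 \<or> degree v + degree (q k) + 1 < card Z"
    and deg: "\<And>j. k < j \<Longrightarrow> j < p \<Longrightarrow> q j = 0 \<or> degree v + \<epsilon> r k j + degree (q j) < card Z"
  shows "(LINT y:I (k + 1)|\<tau> (k + 1). poly v y *
      (y ^ \<epsilon> r k (k + 1) * combination r q (k + 1) y / (\<Prod>x\<in>Z. y - x))) = 0"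
proof -
  let ?J = "I (k + 1)" and ?M = "\<tau> (k + 1)"
  \<comment> \<open>\<open>W x\<close> is the derivative at \<open>x\<close> of the nodal polynomial
    of \<open>Z\<close>, the denominator of the partial fraction weights.\<close>
  define W where "W = (\<lambda>x. \<Prod>u\<in>Z-{x}. x - u)"
  define \<phi> where "\<phi> = (\<lambda>j y. (if k + 1 < j then y else 1) * h (k + 1) j y)"
  define P where "P = (\<lambda>j. v * monom 1 (\<epsilon> r k j) * q j)"
  have disj: "x - y \<noteq> 0" if "x \<in> Z" "y \<in> ?J" for x y
    using disjoint[OF k] Z(2) that by auto
  have \<phi>_cont: "continuous_on ?J (\<phi> j)" if "k < j" "j < p" for j
  proof -
    have "continuous_on ?J (h (k + 1) j)" using that by (intro continuous_on_h) auto
    then show ?thesis unfolding \<phi>_def by (cases "k + 1 < j") (auto intro!: continuous_intros)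
  qed
  have int: "set_integrable ?M ?J (\<lambda>y. poly (P j) x / W x * (\<phi> j y / (x - y)))"
    if "k < j" "j < p" "x \<in> Z" for j x
    using disj[OF that(3)] \<phi>_cont[OF that(1,2)]
    by (intro set_integrable_continuous_compact finite_measure[OF k] sets[OF k] continuous_intros) auto
  have partial: "(\<Sum>x\<in>Z. poly (P j) x / W x * (\<phi> j y / (x - y))) =
      - (poly (P j) y * \<phi> j y / (\<Prod>x\<in>Z. y - x))" if "k < j" "j < p" "y \<in> ?J" for j y
  proof (cases "q j = 0")
    case True
    then show ?thesis by (simp add: P_def)
  next
    case False
    have "degree (P j) \<le> degree v + degree (monom (1::real) (\<epsilon> r k j)) + degree (q j)"
      unfolding P_def using degree_mult_le[of "v * monom 1 (\<epsilon> r k j)" "q j"]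
        degree_mult_le[of v "monom 1 (\<epsilon> r k j)"] by linarith
    also have "\<dots> = degree v + \<epsilon> r k j + degree (q j)" by (simp add: degree_monom_eq)
    also have "\<dots> < card Z" using deg[OF that(1,2)] False by simp
    finally have "poly (P j) y / (\<Prod>x\<in>Z. y - x) = (\<Sum>x\<in>Z. poly (P j) x / (W x * (y - x)))"
      unfolding W_def using disj that(3) by (intro lagrange_partial_fractions Z) auto
    moreover have "poly (P j) y * \<phi> j y / (\<Prod>x\<in>Z. y - x) =
        poly (P j) y / (\<Prod>x\<in>Z. y - x) * \<phi> j y" by simp
    ultimately have "poly (P j) y * \<phi> j y / (\<Prod>x\<in>Z. y - x) =
        (\<Sum>x\<in>Z. poly (P j) x / (W x * (y - x)) * \<phi> j y)"
      by (simp only: sum_distrib_right)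
    also have "\<dots> = (\<Sum>x\<in>Z. - (poly (P j) x / W x * (\<phi> j y / (x - y))))"
    proof (rule sum.cong[OF refl])
      fix x assume "x \<in> Z"
      have e: "s / (w * (y - x)) * t = - (s / w * (t / (x - y)))" for s w t :: real
      proof -
        have "s / (w * (y - x)) * t = s * t / (w * - (x - y))" by simp
        also have "\<dots> = - (s * t / (w * (x - y)))" by (simp only: mult_minus_right divide_minus_right)
        finally show ?thesis by simp
      qed
      show "poly (P j) x / (W x * (y - x)) * \<phi> j y = - (poly (P j) x / W x * (\<phi> j y / (x - y)))"
        by (rule e)
    qed
    finally show ?thesis by (simp add: sum_negf)
  qed
  \<comment> \<open>The term of \<open>combination\<close> without a Cauchy transform drops out;
    this is why \<open>deg_k\<close> asks for a degree gap of two.\<close>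
  have vq: "(\<Sum>x\<in>Z. poly (v * q k) x / W x) = 0"
  proof (cases "q k = 0")
    case False
    then have "degree (v * q k) + 1 < card Z"
      using deg_k degree_mult_le[of v "q k"] by linarith
    then show ?thesis unfolding W_def using Z(1) by (intro lagrange_sum_eq_0)
  qed simp
  \<comment> \<open>The vanishing values are summed with the weights \<open>poly v x / W x\<close>.
    Under the integral, the kernels \<open>1 / (x - y)\<close> then recombine by
    \<open>partial\<close> into a single quotient by the nodal polynomial.\<close>
  have "0 = (\<Sum>x\<in>Z. poly v x / W x * combination r q k x)" using zero by simp
  also have "\<dots> = (\<Sum>x\<in>Z. poly (v * q k) x / W x +
      (\<Sum>j\<in>{k<..<p}. poly (P j) x / W x * h k j x))"
    unfolding combination_def distrib_left sum_distrib_left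
    by (simp add: P_def poly_monom mult_ac)
  also have "\<dots> = (\<Sum>x\<in>Z. \<Sum>j\<in>{k<..<p}. poly (P j) x / W x * h k j x)"
    by (simp only: sum.distrib vq add_0)
  also have "\<dots> = (\<Sum>x\<in>Z. \<Sum>j\<in>{k<..<p}.
      (LINT y:?J|?M. poly (P j) x / W x * (\<phi> j y / (x - y))))"
    by (simp only: set_integral_mult_right) (intro sum.cong refl, simp add: h_less \<phi>_def)
  also have "\<dots> = (\<Sum>j\<in>{k<..<p}. \<Sum>x\<in>Z.
      (LINT y:?J|?M. poly (P j) x / W x * (\<phi> j y / (x - y))))"
    by (rule sum.swap)
  also have "\<dots> = (\<Sum>j\<in>{k<..<p}. \<integral>y. (\<Sum>x\<in>Z. indicator ?J y *\<^sub>R (poly (P j) x / W x * (\<phi> j y / (x - y)))) \<partial>?M)"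
    unfolding set_lebesgue_integral_def using int
    by (intro sum.cong refl Bochner_Integration.integral_sum[symmetric]) (auto simp: set_integrable_def)
  also have "\<dots> = (\<integral>y. (\<Sum>j\<in>{k<..<p}. \<Sum>x\<in>Z. indicator ?J y *\<^sub>R (poly (P j) x / W x * (\<phi> j y / (x - y)))) \<partial>?M)"
    using int by (intro Bochner_Integration.integral_sum[symmetric] Bochner_Integration.integrable_sum)
      (auto simp: set_integrable_def)
  also have "\<dots> = (\<integral>y. - (indicator ?J y *\<^sub>R (poly v y *
      (y ^ \<epsilon> r k (k + 1) * combination r q (k + 1) y / (\<Prod>x\<in>Z. y - x)))) \<partial>?M)"
  proof (rule Bochner_Integration.integral_cong[OF refl])
    fix y
    have "(\<Sum>j\<in>{k<..<p}. \<Sum>x\<in>Z. poly (P j) x / W x * (\<phi> j y / (x - y))) =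
        - (poly v y * (y ^ \<epsilon> r k (k + 1) * combination r q (k + 1) y / (\<Prod>x\<in>Z. y - x)))"
      if y: "y \<in> ?J"
    proof -
      have "(\<Sum>j\<in>{k<..<p}. \<Sum>x\<in>Z. poly (P j) x / W x * (\<phi> j y / (x - y))) =
          (\<Sum>j\<in>{k<..<p}. - (poly (P j) y * \<phi> j y / (\<Prod>x\<in>Z. y - x)))"
        using y partial by (intro sum.cong) auto
      also have "\<dots> = - (poly v y * (\<Sum>j\<in>{k<..<p}. y ^ \<epsilon> r k j * poly (q j) y * \<phi> j y) / (\<Prod>x\<in>Z. y - x))"
        by (simp add: sum_negf sum_divide_distrib sum_distrib_left P_def poly_monom mult_ac)
      finally show ?thesis unfolding combination_Suc[OF k] \<phi>_def by simp
    qed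
    then show "(\<Sum>j\<in>{k<..<p}. \<Sum>x\<in>Z. indicator ?J y *\<^sub>R (poly (P j) x / W x * (\<phi> j y / (x - y)))) =
        - (indicator ?J y *\<^sub>R (poly v y *
          (y ^ \<epsilon> r k (k + 1) * combination r q (k + 1) y / (\<Prod>x\<in>Z. y - x))))"
      by (cases "y \<in> ?J") simp_all
  qed
  finally show ?thesis by (simp add: set_lebesgue_integral_def)
qed

text \<open>Descent through the levels. With too many zeros at level \<open>k\<close>,
  \<open>combination_orthogonal\<close> and \<open>orthogonal_imp_many_zeros\<close> force at least
  \<open>\<Sum>j=k+1..<p. N j\<close> zeros at level \<open>k + 1\<close>, against the induction
  hypothesis. The descent stops when only the polynomial \<open>q k\<close> is left.\<close>

lemma combination_zeros:
  assumes "k < p"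
    and "\<And>j. k \<le> j \<Longrightarrow> j < p \<Longrightarrow> q j = 0 \<or> degree (q j) < N j"
    and "\<And>i j. k \<le> i \<Longrightarrow> i < j \<Longrightarrow> j < p \<Longrightarrow> N j + \<epsilon> r i j \<le> N i + 1"
    and "\<exists>j\<in>{k..<p}. q j \<noteq> 0"
    and "finite Z" "Z \<subseteq> {a k<..<b k}" "\<And>x. x \<in> Z \<Longrightarrow> combination r q k x = 0"
  shows "card Z < (\<Sum>j=k..<p. N j)"
  using assms
proof (induction "p - k" arbitrary: k Z)
  case 0
  then show ?case by simp
next
  case (Suc n)
  note k = \<open>k < p\<close> and deg = Suc.prems(2) and mono = Suc.prems(3) and Z = Suc.prems(5-7)
  have sum_eq: "(\<Sum>j=k..<p. N j) = N k + (\<Sum>j=k+1..<p. N j)"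
    using k by (simp add: sum.atLeast_Suc_lessThan)
  show ?case
  proof (cases "\<exists>j\<in>{k+1..<p}. q j \<noteq> 0")
    case False
    then have "combination r q k x = poly (q k) x" for x
      unfolding combination_def by (intro add_0_iff[THEN iffD2] sum.neutral | simp)+
    moreover have qk: "q k \<noteq> 0"
    proof -
      have "{k..<p} = insert k {k+1..<p}" using k by auto
      then show ?thesis using Suc.prems(4) False by auto
    qed
    ultimately have "card Z \<le> degree (q k)"
      using poly_eq_0_of_card_roots[OF Z(1), of "q k"] Z(3) by force
    also have "degree (q k) < N k" using deg[of k] k qk by auto
    finally show ?thesis using sum_eq by simp
  next
    case True
    then have k1: "k + 1 < p" by auto
    show ?thesis
    proof (rule ccontr)
      assume "\<not> ?thesis"
      then have card: "N k + (\<Sum>j=k+1..<p. N j) \<le> card Z" using sum_eq by simp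
      let ?N = "\<Sum>j=k+1..<p. N j"
      let ?g = "\<lambda>y. y ^ \<epsilon> r k (k + 1) * combination r q (k + 1) y / (\<Prod>x\<in>Z. y - x)"
      let ?a = "a (k + 1)" and ?b = "b (k + 1)"
      have ZI: "Z \<subseteq> I k" using Z(2) by force
      have W: "(\<Prod>x\<in>Z. y - x) \<noteq> 0" if "y \<in> {?a..?b}" for y
        using disjoint[OF k1] ZI that Z(1) by (auto simp: prod_zero_iff)
      have IH: "card Y < ?N" if "finite Y" "Y \<subseteq> {y\<in>{?a<..<?b}. combination r q (k + 1) y = 0}" for Y
      proof (rule Suc.hyps(1))
        show "n = p - (k + 1)" using Suc.hyps(2) by simp
        show "N j + \<epsilon> r i j \<le> N i + 1" if "k + 1 \<le> i" "i < j" "j < p" for i j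
          using that mono[of i j] by simp
        show "q j = 0 \<or> degree (q j) < N j" if "k + 1 \<le> j" "j < p" for j
          using that deg[of j] by simp
      qed (use True k1 that in auto)
      \<comment> \<open>Neither the power of \<open>y\<close> nor the denominator matters for the
        zeros, since the open interval does not contain 0 and \<open>Z\<close> lies in the disjoint
        neighbouring interval.\<close>
      have Zeq: "{y\<in>{?a<..<?b}. ?g y = 0} = {y\<in>{?a<..<?b}. combination r q (k + 1) y = 0}"
      proof -
        have "?g y = 0 \<longleftrightarrow> combination r q (k + 1) y = 0" if y: "y \<in> {?a<..<?b}" for y
          using W[of y] y zero_not_inside[OF k1] by (cases "y = 0") auto
        then show ?thesis by blast
      qed
      \<comment> \<open>An infinite zero set would contain a finite one with \<open>?N\<close>
        elements, which \<open>IH\<close> excludes.\<close>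
      have fin: "finite {y\<in>{?a<..<?b}. ?g y = 0}"
        unfolding Zeq
      proof (rule ccontr)
        assume inf: "infinite {y\<in>{?a<..<?b}. combination r q (k + 1) y = 0}"
        obtain Y where "finite Y" "card Y = ?N" "Y \<subseteq> {y\<in>{?a<..<?b}. combination r q (k + 1) y = 0}"
          using infinite_arbitrarily_large[OF inf] by blast
        with IH[of Y] show False by simp
      qed
      have "?N \<le> card {y\<in>{?a<..<?b}. ?g y = 0}"
      proof (rule orthogonal_imp_many_zeros[OF finite_measure[OF k1] sets[OF k1]
            not_finitely_supported[OF k1] less[OF k1] _ _ fin])
        show "continuous_on {?a..?b} ?g"
          using W by (intro continuous_intros continuous_on_combination k1) auto
        fix v :: "real poly" assume v: "degree v < ?N"
        \<comment> \<open>The degree count closes exactly: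
          \<open>N j + \<epsilon> r k j \<le> N k + 1\<close> and the strict bounds on both degrees
          give at most \<open>?N + N k - 1\<close>.\<close>
        show "(LINT y:{?a..?b}|\<tau> (k + 1). poly v y * ?g y) = 0"
        proof (rule combination_orthogonal[OF k1 Z(1) ZI Z(3)])
          show "q k = 0 \<or> degree v + degree (q k) + 1 < card Z"
            using deg[of k] k v card by linarith
          show "q j = 0 \<or> degree v + \<epsilon> r k j + degree (q j) < card Z" if "k < j" "j < p" for j
            using deg[of j] mono[of k j] that v card by linarith
        qed
      qed
      moreover have "card {y\<in>{?a<..<?b}. ?g y = 0} < ?N"
        using IH[OF fin] unfolding Zeq by simp
      ultimately show False by simp
    qed
  qed
qed

text \<open>The orthogonality condition of index \<open>r + (p + 1) * t\<close>, applied to \<open>z ^ (r + (p + 1) * s)\<close>, is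
  the integral of \<open>x ^ s * \<phi> (r + t) x\<close>.\<close>

definition \<phi> :: "nat \<Rightarrow> real \<Rightarrow> real" where
  "\<phi> w x = x ^ (w div p + (if w mod p = 0 then 0 else 1)) * h 0 (w mod p) x"

lemma continuous_on_\<phi>: "0 < p \<Longrightarrow> continuous_on (I 0) (\<phi> w)"
  unfolding \<phi>_def[abs_def] by (intro continuous_intros continuous_on_h) auto

section \<open>Chebyshev systems and invertible moment matrices\<close>

text \<open>Grouping the indices \<open>w\<close> by their residue \<open>j\<close> modulo
  \<open>p\<close> turns the sum into a \<open>combination\<close> with polynomials
  \<open>q j\<close>, up to a factor \<open>x\<close> when \<open>r\<close> is nonzero. The lengths
  \<open>N j\<close> add up to \<open>d\<close>, so \<open>combination_zeros\<close>
  applies.\<close>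

lemma chebyshev_system:
  assumes p: "0 < p" and r: "r \<le> p" and c: "\<exists>w\<in>{r..<r + d}. c w \<noteq> 0"
    and Z: "finite Z" "Z \<subseteq> {a 0<..<b 0}" "\<And>x. x \<in> Z \<Longrightarrow> (\<Sum>w=r..<r + d. c w * \<phi> w x) = 0"
  shows "card Z < d"
proof -
  \<comment> \<open>For \<open>j < r\<close> the first index congruent to \<open>j\<close> that is
    at least \<open>r\<close> is \<open>j + p\<close>, not \<open>j\<close>; this uses
    \<open>r \<le> p\<close>. Thus \<open>ix (j, m)\<close> runs through class \<open>j\<close> from
    its first admissible index on, and \<open>N j\<close> counts those below
    \<open>r + d\<close>.\<close>
  define \<delta> where "\<delta> = (\<lambda>j. if j < r then 1 else 0 :: nat)"
  define N where "N = (\<lambda>j. LEAST m. r + d \<le> j + p * (m + \<delta> j))"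
  define ix where "ix = (\<lambda>(j, m). j + p * (m + \<delta> j))"
  define q where "q = (\<lambda>j. \<Sum>m<N j. monom (c (ix (j, m))) m)"
  have N_upper: "r + d \<le> j + p * (N j + \<delta> j)" for j
    unfolding N_def
  proof (rule LeastI)
    have "r + d \<le> p * (r + d)" using p by simp
    then show "r + d \<le> j + p * ((r + d) + \<delta> j)" by (simp add: distrib_left)
  qed
  have N_le: "N j \<le> m" if "r + d \<le> j + p * (m + \<delta> j)" for j m
    unfolding N_def by (rule Least_le) (rule that)
  have less_N: "m < N j \<longleftrightarrow> ix (j, m) < r + d" for j m
  proof
    assume "m < N j"
    then show "ix (j, m) < r + d" using N_le[of j m] by (auto simp: ix_def not_less[symmetric])
  next
    assume "ix (j, m) < r + d"
    then have "j + p * (m + \<delta> j) < j + p * (N j + \<delta> j)"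
      using N_upper[of j] by (simp only: ix_def prod.case)
    then show "m < N j" by simp
  qed
  have bij: "bij_betw ix (Sigma {..<p} (\<lambda>j. {..<N j})) {r..<r + d}"
  proof (rule bij_betwI')
    fix u v assume uv: "u \<in> Sigma {..<p} (\<lambda>j. {..<N j})" "v \<in> Sigma {..<p} (\<lambda>j. {..<N j})"
    obtain j m j' m' where eq: "u = (j, m)" "v = (j', m')" by (cases u, cases v)
    have lt: "j < p" "j' < p" using uv eq by auto
    have "u = v" if "ix u = ix v"
    proof -
      have "(j + p * (m + \<delta> j)) mod p = (j' + p * (m' + \<delta> j')) mod p"
        "(j + p * (m + \<delta> j)) div p = (j' + p * (m' + \<delta> j')) div p"
        using that by (simp_all add: ix_def eq)
      then show ?thesis using lt p eq by auto
    qed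
    then show "(ix u = ix v) = (u = v)" by auto
  next
    fix u assume u: "u \<in> Sigma {..<p} (\<lambda>j. {..<N j})"
    obtain j m where eq: "u = (j, m)" by (cases u)
    have "ix u < r + d" using u less_N by (auto simp: eq)
    moreover have "r \<le> ix u"
    proof (cases "j < r")
      case True
      have "r \<le> p * 1" using r by simp
      also have "\<dots> \<le> p * (m + \<delta> j)" by (rule mult_le_mono2) (simp add: \<delta>_def True)
      finally show ?thesis by (simp add: ix_def eq)
    qed (simp add: ix_def eq)
    ultimately show "ix u \<in> {r..<r + d}" by simp
  next
    fix w assume w: "w \<in> {r..<r + d}"
    let ?j = "w mod p" and ?m = "w div p - \<delta> (w mod p)"
    have "\<delta> ?j \<le> w div p"
    proof (cases "?j < r")
      case True
      then have "?j \<noteq> w" using w by auto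
      then have "w div p \<noteq> 0" using div_mult_mod_eq[of w p] by (metis add_0 mult_0)
      then show ?thesis by (simp add: \<delta>_def)
    qed (simp add: \<delta>_def)
    then have "w = ix (?j, ?m)" by (simp add: ix_def)
    moreover from this have "?m < N ?j" using less_N w by auto
    ultimately show "\<exists>u\<in>Sigma {..<p} (\<lambda>j. {..<N j}). w = ix u"
      using p by (intro bexI[of _ "(?j, ?m)"]) auto
  qed
  have sum_N: "(\<Sum>j=0..<p. N j) = d"
    using bij_betw_same_card[OF bij] by (simp add: card_SigmaI lessThan_atLeast0)
  \<comment> \<open>The exponent of \<open>x\<close> in \<open>\<phi> (ix (j, m))\<close> beyond
    \<open>m\<close> splits into a part independent of \<open>j\<close>, which is factored out, and
    the exponent that \<open>combination\<close> prescribes.\<close>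
  have eps: "\<delta> j + (if j = 0 then 0 else 1) = (if r = 0 then 0 else 1) + (if j = 0 then 0 else \<epsilon> r 0 j)" for j
    by (auto simp: \<delta>_def \<epsilon>_def)
  have \<phi>_ix: "\<phi> (ix (j, m)) x =
      x ^ m * x ^ ((if r = 0 then 0 else 1) + (if j = 0 then 0 else \<epsilon> r 0 j)) * h 0 j x"
    if "j < p" for j m x
  proof -
    have "ix (j, m) mod p = j" "ix (j, m) div p = m + \<delta> j" using that p by (auto simp: ix_def)
    then show ?thesis by (simp only: \<phi>_def eps[symmetric] power_add mult.assoc)
  qed
  have sum_eq: "(\<Sum>w=r..<r + d. c w * \<phi> w x) =
      x ^ (if r = 0 then 0 else 1) * combination r q 0 x" for x
  proof -
    have "(\<Sum>w=r..<r + d. c w * \<phi> w x) =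
        (\<Sum>u\<in>Sigma {..<p} (\<lambda>j. {..<N j}). c (ix u) * \<phi> (ix u) x)"
      by (rule sum.reindex_bij_betw[OF bij, symmetric])
    also have "\<dots> = (\<Sum>j<p. \<Sum>m<N j. c (ix (j, m)) * \<phi> (ix (j, m)) x)"
      by (subst sum.Sigma) auto
    also have "\<dots> = (\<Sum>j<p. x ^ (if r = 0 then 0 else 1) *
        (x ^ (if j = 0 then 0 else \<epsilon> r 0 j) * poly (q j) x * h 0 j x))"
      by (intro sum.cong refl)
        (simp add: \<phi>_ix q_def poly_sum poly_monom sum_distrib_left sum_distrib_right power_add mult_ac)
    also have "\<dots> = x ^ (if r = 0 then 0 else 1) *
        (\<Sum>j<p. x ^ (if j = 0 then 0 else \<epsilon> r 0 j) * poly (q j) x * h 0 j x)"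
      by (rule sum_distrib_left[symmetric])
    also have "{..<p} = insert 0 {0<..<p}" using p by auto
    also have "(\<Sum>j\<in>insert 0 {0<..<p}. x ^ (if j = 0 then 0 else \<epsilon> r 0 j) * poly (q j) x * h 0 j x) =
        combination r q 0 x"
      by (simp add: combination_def)
    finally show ?thesis .
  qed
  have "card Z < (\<Sum>j=0..<p. N j)"
  proof (rule combination_zeros[OF p])
    show "q j = 0 \<or> degree (q j) < N j" for j
    proof (cases "N j = 0")
      case False
      have "degree (monom (c (ix (j, m))) m) < N j" if "m < N j" for m
        using degree_monom_le[of "c (ix (j, m))" m] that by linarith
      then have "degree (q j) < N j"
        unfolding q_def using False by (intro degree_sum_less) auto
      then show ?thesis ..
    qed (simp add: q_def)
    \<comment> \<open>If \<open>i < r \<le> j\<close>, class \<open>j\<close> starts one period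
      earlier than class \<open>i\<close> and may contain one more index, but then
      \<open>\<epsilon>\<close> is 0. Otherwise the later class is no longer than the earlier
      one.\<close>
    show "N j + \<epsilon> r i j \<le> N i + 1" if "i < j" for i j
    proof (cases "i < r \<and> r \<le> j")
      case True
      have "r + d \<le> i + p * (N i + \<delta> i)" by (rule N_upper)
      also have "\<dots> \<le> j + p * (N i + 1 + \<delta> j)" using True that by (simp add: \<delta>_def)
      finally have "N j \<le> N i + 1" by (rule N_le)
      then show ?thesis using True by (simp add: \<epsilon>_def)
    next
      case False
      have "r + d \<le> i + p * (N i + \<delta> i)" by (rule N_upper)
      also have "\<dots> \<le> j + p * (N i + \<delta> j)" using False that by (auto simp: \<delta>_def)
      finally have "N j \<le> N i" by (rule N_le)
      then show ?thesis using False by (auto simp: \<epsilon>_def)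
    qed
    show "\<exists>j\<in>{0..<p}. q j \<noteq> 0"
    proof -
      obtain w where w: "w \<in> {r..<r + d}" "c w \<noteq> 0" using c by blast
      obtain j m where jm: "j < p" "m < N j" "w = ix (j, m)"
      proof -
        have "w \<in> ix ` Sigma {..<p} (\<lambda>j. {..<N j})"
          using bij_betw_imp_surj_on[OF bij] w(1) by simp
        then show ?thesis using that by blast
      qed
      have "coeff (q j) m = c w" using jm by (simp add: q_def coeff_sum)
      then have "q j \<noteq> 0" using w(2) by auto
      then show ?thesis using jm(1) by (intro bexI[of _ j]) auto
    qed
    show "combination r q 0 x = 0" if "x \<in> Z" for x
    proof -
      have "x \<noteq> 0" using zero_not_inside[OF p] Z(2) that by auto
      then show ?thesis using Z(3)[OF that] unfolding sum_eq by auto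
    qed
  qed (use Z in auto)
  then show ?thesis by (simp only: sum_N)
qed

text \<open>A left kernel vector gives a function \<open>G\<close> orthogonal to all polynomials of
  degree below \<open>d\<close>. It would have at least \<open>d\<close> zeros, while
  \<open>chebyshev_system\<close> allows fewer.\<close>

lemma moment_matrix_left_kernel:
  assumes p: "0 < p" and r: "r \<le> p"
    and orth: "\<forall>s<d. (\<Sum>t<d. e t * (LINT x:I 0|\<tau> 0. x ^ s * \<phi> (r + t) x)) = 0"
  shows "\<forall>t<d. e t = 0"
proof (rule ccontr)
  assume nz: "\<not> ?thesis"
  define G where "G = (\<lambda>x. \<Sum>t<d. e t * \<phi> (r + t) x)"
  have G_eq: "G x = (\<Sum>w=r..<r + d. e (w - r) * \<phi> w x)" for x
    unfolding G_def by (rule sum.reindex_bij_witness[of _ "\<lambda>w. w - r" "\<lambda>t. r + t"]) auto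
  have "\<exists>w\<in>{r..<r + d}. e (w - r) \<noteq> 0" proof -
    obtain t where "t < d" "e t \<noteq> 0" using nz by blast
    then show ?thesis by (intro bexI[of _ "r + t"]) auto
  qed
  then have card: "card Z < d" if "finite Z" "Z \<subseteq> {x\<in>{a 0<..<b 0}. G x = 0}" for Z
    using that by (intro chebyshev_system[OF p r, of d "\<lambda>w. e (w - r)"]) (auto simp: G_eq)
  have fin: "finite {x\<in>{a 0<..<b 0}. G x = 0}"
  proof (rule ccontr)
    assume inf: "infinite {x\<in>{a 0<..<b 0}. G x = 0}"
    obtain Y where "finite Y" "card Y = d" "Y \<subseteq> {x\<in>{a 0<..<b 0}. G x = 0}"
      using infinite_arbitrarily_large[OF inf] by blast
    with card[of Y] show False by simp
  qed
  have cont: "continuous_on (I 0) G"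
    unfolding G_def by (intro continuous_intros continuous_on_\<phi> p)
  have int: "integrable (\<tau> 0) (\<lambda>x. indicator (I 0) x *\<^sub>R (x ^ s * f x))"
    if "continuous_on (I 0) f" for f :: "real \<Rightarrow> real" and s
    using that unfolding set_integrable_def[symmetric]
    by (intro set_integrable_continuous_compact finite_measure sets p continuous_intros) auto
  have mom: "(LINT x:I 0|\<tau> 0. x ^ s * G x) = 0" if "s < d" for s
  proof -
    have "(LINT x:I 0|\<tau> 0. x ^ s * G x) =
        (\<integral>x. (\<Sum>t<d. e t * (indicator (I 0) x *\<^sub>R (x ^ s * \<phi> (r + t) x))) \<partial>\<tau> 0)"
      unfolding set_lebesgue_integral_def G_def
      by (intro Bochner_Integration.integral_cong refl) (simp add: sum_distrib_left mult_ac)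
    also have "\<dots> = (\<Sum>t<d. \<integral>x. e t * (indicator (I 0) x *\<^sub>R (x ^ s * \<phi> (r + t) x)) \<partial>\<tau> 0)"
      by (intro Bochner_Integration.integral_sum integrable_mult_right int continuous_on_\<phi> p)
    also have "\<dots> = (\<Sum>t<d. e t * (LINT x:I 0|\<tau> 0. x ^ s * \<phi> (r + t) x))"
      by (simp add: set_lebesgue_integral_def)
    finally show ?thesis using orth that by simp
  qed
  have "d \<le> card {x\<in>{a 0<..<b 0}. G x = 0}"
  proof (rule orthogonal_imp_many_zeros[OF finite_measure[OF p] sets[OF p]
        not_finitely_supported[OF p] less[OF p] cont _ fin])
    fix v :: "real poly" assume v: "degree v < d"
    have "(LINT x:I 0|\<tau> 0. poly v x * G x) =
        (\<integral>x. (\<Sum>s\<le>degree v. coeff v s * (indicator (I 0) x *\<^sub>R (x ^ s * G x))) \<partial>\<tau> 0)"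
      unfolding set_lebesgue_integral_def poly_altdef
      by (intro Bochner_Integration.integral_cong refl) (simp add: sum_distrib_left sum_distrib_right mult_ac)
    also have "\<dots> = (\<Sum>s\<le>degree v. \<integral>x. coeff v s * (indicator (I 0) x *\<^sub>R (x ^ s * G x)) \<partial>\<tau> 0)"
      by (intro Bochner_Integration.integral_sum integrable_mult_right int cont)
    also have "\<dots> = (\<Sum>s\<le>degree v. coeff v s * (LINT x:I 0|\<tau> 0. x ^ s * G x))"
      by (simp add: set_lebesgue_integral_def)
    also have "\<dots> = 0" using mom v by (intro sum.neutral) auto
    finally show "(LINT x:I 0|\<tau> 0. poly v x * G x) = 0" .
  qed
  with card[OF fin] show False by simp
qed

lemma moment_matrix_right_kernel:
  assumes "0 < p" "r \<le> p"
    and "\<forall>t<d. (\<Sum>s<d. (LINT x:I 0|\<tau> 0. x ^ s * \<phi> (r + t) x) * c s) = 0"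
  shows "\<forall>s<d. c s = 0"
proof (rule trivial_kernel_transpose[OF _ assms(3)])
  fix e assume "\<forall>s<d. (\<Sum>t<d. e t * (LINT x:I 0|\<tau> 0. x ^ s * \<phi> (r + t) x)) = 0"
  then show "\<forall>t<d. e t = 0" by (rule moment_matrix_left_kernel[OF assms(1,2)])
qed

end

section \<open>Reduction from the star to the interval\<close>

locale star_nikishin =
  fixes p :: nat
    and a b :: "nat \<Rightarrow> real"
    and \<Gamma> :: "nat \<Rightarrow> complex set"
    and \<sigma> :: "nat \<Rightarrow> complex measure"
  assumes p: "p \<ge> 1"
    and ab_even: "\<And>j. j < p \<Longrightarrow> even j \<Longrightarrow> 0 \<le> a j \<and> a j < b j"
    and ab_odd: "\<And>j. j < p \<Longrightarrow> odd j \<Longrightarrow> a j < b j \<and> b j \<le> 0"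
    and \<Gamma>: "\<And>j. \<Gamma> j = star p (a j) (b j)"
    and \<Gamma>_disjoint: "\<And>j. j + 1 < p \<Longrightarrow> \<Gamma> j \<inter> \<Gamma> (j + 1) = {}"
    and finite_\<sigma>: "\<And>j. j < p \<Longrightarrow> finite_measure (\<sigma> j)"
    and sets_\<sigma>: "\<And>j. j < p \<Longrightarrow> sets (\<sigma> j) = sets borel"
    and \<sigma>_outside: "\<And>j. j < p \<Longrightarrow> emeasure (\<sigma> j) (- \<Gamma> j) = 0"
    and \<sigma>_rotation: "\<And>j. j < p \<Longrightarrow> distr (\<sigma> j) borel (\<lambda>z. cis (2 * pi / real (p + 1)) * z) = \<sigma> j"
    and \<sigma>_support: "\<And>j. j < p \<Longrightarrow> infinite (measure_support (\<sigma> j))"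
begin

text \<open>The variable \<open>x = z ^ (p + 1)\<close>. The real part makes it real on the whole
  plane; on \<Gamma> nothing is lost, as the power is real there.\<close>

definition rp :: "complex \<Rightarrow> real" where "rp z = Re (z ^ (p + 1))"

definition \<tau> :: "nat \<Rightarrow> real measure" where "\<tau> k = distr (\<sigma> k) borel rp"

lemma in_\<Gamma>_iff: "z \<in> \<Gamma> k \<longleftrightarrow> z ^ (p + 1) = complex_of_real (rp z) \<and> rp z \<in> {a k..b k}"
proof -
  have "w \<in> complex_of_real ` S \<longleftrightarrow> w = complex_of_real (Re w) \<and> Re w \<in> S" for w S
    by (metis Re_complex_of_real image_iff)
  then show ?thesis unfolding \<Gamma> star_def rp_def by simp
qed

lemma continuous_on_rp [continuous_intros]: "continuous_on S rp"
  unfolding rp_def[abs_def] by (intro continuous_intros)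

lemma rp_measurable [measurable]: "rp \<in> borel_measurable borel"
  by (rule borel_measurable_continuous_onI) (rule continuous_on_rp)

lemma measurable_\<sigma>: "k < p \<Longrightarrow> f \<in> measurable borel N \<Longrightarrow> f \<in> measurable (\<sigma> k) N"
  using measurable_cong_sets[OF sets_\<sigma> refl, of k N] by simp

lemma compact_\<Gamma>: "compact (\<Gamma> k)"
proof -
  have "\<Gamma> k = (\<lambda>z. z ^ (p + 1)) -` (complex_of_real ` {a k..b k})"
    unfolding \<Gamma> star_def by auto
  moreover have cpt: "compact (complex_of_real ` {a k..b k})"
    by (intro compact_continuous_image continuous_intros) auto
  ultimately have "closed (\<Gamma> k)"
    using continuous_closed_vimage[OF compact_imp_closed[OF cpt], of "\<lambda>z. z ^ (p + 1)"]
    by (simp add: continuous_intros)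
  moreover have "bounded (\<Gamma> k)"
  proof -
    obtain B where B: "\<And>w. w \<in> complex_of_real ` {a k..b k} \<Longrightarrow> norm w \<le> B"
      using compact_imp_bounded[OF cpt] unfolding bounded_iff by blast
    have "norm z \<le> max 1 B" if "z \<in> \<Gamma> k" for z
    proof (cases "norm z \<le> 1")
      case False
      have "norm z ^ 1 \<le> norm z ^ (p + 1)" using False by (intro power_increasing) auto
      also have "\<dots> = norm (z ^ (p + 1))" by (simp only: norm_power)
      also have "\<dots> \<le> B" using that by (intro B) (simp add: \<Gamma> star_def)
      finally show ?thesis by simp
    qed auto
    then show ?thesis unfolding bounded_iff by blast
  qed
  ultimately show ?thesis by (simp add: compact_eq_bounded_closed)
qed

lemma borel_\<Gamma> [measurable]: "\<Gamma> k \<in> sets borel"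
  by (rule borel_compact) (rule compact_\<Gamma>)

lemma AE_in_\<Gamma>: "k < p \<Longrightarrow> AE z in \<sigma> k. z \<in> \<Gamma> k"
  using \<sigma>_outside[of k] borel_comp[OF borel_\<Gamma>[of k]] sets_\<sigma>[of k]
  by (intro AE_I[where N = "- \<Gamma> k"]) auto

text \<open>The preimage \<open>S\<close> of a finite set under \<open>z ^ (p + 1)\<close> is
  finite. If the measure lived on it, the open set \<open>- S\<close> would be null and the support
  would lie in \<open>S\<close>.\<close>

lemma not_finite_AE:
  assumes k: "k < p" and F: "finite F"
  shows "\<not> (AE x in \<tau> k. x \<in> {a k..b k} \<longrightarrow> x \<in> F)"
proof
  assume "AE x in \<tau> k. x \<in> {a k..b k} \<longrightarrow> x \<in> F"
  moreover have "F \<in> sets borel" using F by (intro borel_closed finite_imp_closed)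
  then have "{x. x \<in> {a k..b k} \<longrightarrow> x \<in> F} \<in> sets borel" by measurable
  ultimately have "AE z in \<sigma> k. rp z \<in> {a k..b k} \<longrightarrow> rp z \<in> F"
    unfolding \<tau>_def using k by (subst (asm) AE_distr_iff) (auto intro!: measurable_\<sigma>)
  define S where "S = (\<Union>y\<in>F. {z. z ^ (p + 1) = complex_of_real y})"
  have "finite S" unfolding S_def using F by (intro finite_UN_I finite_nth_roots) auto
  have "AE z in \<sigma> k. z \<in> S"
    using AE_in_\<Gamma>[OF k] \<open>AE z in \<sigma> k. rp z \<in> {a k..b k} \<longrightarrow> rp z \<in> F\<close>
  proof eventually_elim
    case (elim z)
    then show ?case unfolding in_\<Gamma>_iff S_def by blast
  qed
  moreover have open_S: "open (- S)" using \<open>finite S\<close> by (simp add: finite_imp_closed open_Compl)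
  ultimately have null: "emeasure (\<sigma> k) (- S) = 0"
    using k AE_iff_null_sets[of "- S" "\<sigma> k"] by (simp add: sets_\<sigma> null_sets_def)
  have "measure_support (\<sigma> k) \<subseteq> S"
  proof
    fix z assume "z \<in> measure_support (\<sigma> k)"
    then have "z \<in> - S \<Longrightarrow> emeasure (\<sigma> k) (- S) > 0"
      unfolding measure_support_def using open_S by blast
    then show "z \<in> S" using null by auto
  qed
  then show False using \<sigma>_support[OF k] \<open>finite S\<close> finite_subset by blast
qed

sublocale interval_nikishin p a b \<tau>
proof (rule interval_nikishin.intro)
  fix k assume k: "k < p"
  show "a k < b k" using ab_even[OF k] ab_odd[OF k] by blast
  show "0 \<notin> {a k<..<b k}" using ab_even[OF k] ab_odd[OF k] by (cases "even k") auto
  show "finite_measure (\<tau> k)"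
    unfolding \<tau>_def by (intro finite_measure.finite_measure_distr finite_\<sigma> k measurable_\<sigma> rp_measurable)
  show "sets (\<tau> k) = sets borel" by (simp add: \<tau>_def)
  fix F :: "real set" assume "finite F"
  then show "\<not> (AE x in \<tau> k. x \<in> {a k..b k} \<longrightarrow> x \<in> F)"
    by (rule not_finite_AE[OF k])
next
  fix k assume k: "k + 1 < p"
  show "{a k..b k} \<inter> {a (k + 1)..b (k + 1)} = {}"
  proof (rule ccontr)
    assume "\<not> ?thesis"
    then obtain x where x: "x \<in> {a k..b k}" "x \<in> {a (k + 1)..b (k + 1)}" by blast
    \<comment> \<open>A \<open>(p + 1)\<close>-th root of a common point of two neighbouring
      intervals lies on both stars.\<close>
    obtain z where z: "complex_of_real x = z ^ (p + 1)"
      by (rule exists_complex_root[of "p + 1" "complex_of_real x"]) auto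
    then have "z \<in> \<Gamma> k \<inter> \<Gamma> (k + 1)"
      using x unfolding \<Gamma> star_def z[symmetric] by (simp only: Int_iff mem_Collect_eq z[symmetric]) blast
    then show False using \<Gamma>_disjoint[OF k] by blast
  qed
qed

text \<open>If \<open>p + 1\<close> divides \<open>m\<close>, then \<open>z ^ m\<close> is a power
  of \<open>rp z\<close> and the integral is carried to the image measure. Otherwise rotation
  invariance multiplies the integral by \<open>\<omega> ^ m\<close>, which is not 1, so it
  vanishes.\<close>

lemma star_integral:
  fixes f :: "real \<Rightarrow> real"
  assumes k: "k < p" and f: "continuous_on (I k) f"
  shows "(LINT z:\<Gamma> k|\<sigma> k. z ^ m * complex_of_real (f (rp z))) = complex_of_real
    (if (p + 1) dvd m then LINT x:I k|\<tau> k. x ^ (m div (p + 1)) * f x else 0)"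
proof (cases "(p + 1) dvd m")
  case True
  then obtain s where m: "m = (p + 1) * s" by blast
  have meas: "(\<lambda>x. indicator (I k) x *\<^sub>R (x ^ s * f x)) \<in> borel_measurable borel"
    by (intro borel_measurable_continuous_on_indicator continuous_intros f) auto
  have cont: "continuous_on (\<Gamma> k) (\<lambda>z. z ^ m * complex_of_real (f (rp z)))"
    by (intro continuous_intros continuous_on_compose2[OF f]) (auto simp: in_\<Gamma>_iff)
  have "(LINT x:I k|\<tau> k. x ^ (m div (p + 1)) * f x) = (LINT x:I k|\<tau> k. x ^ s * f x)"
    unfolding m by (subst nonzero_mult_div_cancel_left) simp_all
  also have "\<dots> = (\<integral>z. indicator (I k) (rp z) *\<^sub>R (rp z ^ s * f (rp z)) \<partial>\<sigma> k)"
    unfolding set_lebesgue_integral_def \<tau>_def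
    using k meas by (intro integral_distr measurable_\<sigma> rp_measurable)
  finally have "complex_of_real (LINT x:I k|\<tau> k. x ^ (m div (p + 1)) * f x) =
      (\<integral>z. complex_of_real (indicator (I k) (rp z) *\<^sub>R (rp z ^ s * f (rp z))) \<partial>\<sigma> k)"
    by (simp only: integral_complex_of_real)
  also have "\<dots> = (\<integral>z. indicator (\<Gamma> k) z *\<^sub>R (z ^ m * complex_of_real (f (rp z))) \<partial>\<sigma> k)"
  proof (rule integral_cong_AE)
    show "(\<lambda>z. complex_of_real (indicator (I k) (rp z) *\<^sub>R (rp z ^ s * f (rp z)))) \<in> borel_measurable (\<sigma> k)"
      by (intro measurable_\<sigma>[OF k] measurable_compose[OF measurable_compose[OF rp_measurable meas]]
          borel_measurable_continuous_onI[where f = complex_of_real] continuous_intros)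
    show "(\<lambda>z. indicator (\<Gamma> k) z *\<^sub>R (z ^ m * complex_of_real (f (rp z)))) \<in> borel_measurable (\<sigma> k)"
      by (intro measurable_\<sigma>[OF k] borel_measurable_continuous_on_indicator borel_\<Gamma> cont)
    show "AE z in \<sigma> k. complex_of_real (indicator (I k) (rp z) *\<^sub>R (rp z ^ s * f (rp z))) =
        indicator (\<Gamma> k) z *\<^sub>R (z ^ m * complex_of_real (f (rp z)))"
      using AE_in_\<Gamma>[OF k]
    proof eventually_elim
      case (elim z)
      then have z: "z ^ (p + 1) = complex_of_real (rp z)" "rp z \<in> I k" by (auto simp only: in_\<Gamma>_iff)
      have "z ^ m = complex_of_real (rp z) ^ s" unfolding m power_mult z(1) ..
      then show ?case using elim z(2) by simp
    qed
  qed
  finally show ?thesis using True by (simp add: set_lebesgue_integral_def)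
next
  case False
  define \<omega> where "\<omega> = cis (2 * pi / real (p + 1))"
  define F where "F = (\<lambda>z. indicator (\<Gamma> k) z *\<^sub>R (z ^ m * complex_of_real (f (rp z))))"
  have \<omega>_pow: "\<omega> ^ n = exp (2 * of_real pi * \<i> * of_nat n / of_nat (p + 1))" for n
    unfolding \<omega>_def cis_conv_exp exp_of_nat_mult[symmetric] by (rule arg_cong[of _ _ exp]) (simp add: mult_ac)
  have "\<omega> ^ (p + 1) = 1" "\<omega> ^ m \<noteq> 1"
    using complex_root_unity_eq_1[of "p + 1" "p + 1"] complex_root_unity_eq_1[of "p + 1" m] False
    unfolding \<omega>_pow by simp_all
  have rp: "(\<omega> * z) ^ (p + 1) = z ^ (p + 1)" "rp (\<omega> * z) = rp z" for z
    using \<open>\<omega> ^ (p + 1) = 1\<close> unfolding rp_def power_mult_distrib by simp_all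
  have F: "F (\<omega> * z) = \<omega> ^ m * F z" for z
  proof -
    have "\<omega> * z \<in> \<Gamma> k \<longleftrightarrow> z \<in> \<Gamma> k" unfolding in_\<Gamma>_iff rp ..
    then show ?thesis by (auto simp: F_def rp(2) power_mult_distrib indicator_def)
  qed
  have cont: "continuous_on (\<Gamma> k) (\<lambda>z. z ^ m * complex_of_real (f (rp z)))"
    by (intro continuous_intros continuous_on_compose2[OF f]) (auto simp: in_\<Gamma>_iff)
  have measF: "F \<in> borel_measurable borel"
    unfolding F_def by (intro borel_measurable_continuous_on_indicator borel_\<Gamma> cont)
  have "integral\<^sup>L (\<sigma> k) F = integral\<^sup>L (distr (\<sigma> k) borel (\<lambda>z. \<omega> * z)) F"
    using \<sigma>_rotation[OF k] by (simp only: \<omega>_def)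
  also have "\<dots> = (\<integral>z. F (\<omega> * z) \<partial>\<sigma> k)"
    using measF by (intro integral_distr measurable_\<sigma>[OF k]) auto
  also have "\<dots> = \<omega> ^ m * integral\<^sup>L (\<sigma> k) F" unfolding F by simp
  finally have "(1 - \<omega> ^ m) * integral\<^sup>L (\<sigma> k) F = 0" by (simp add: algebra_simps)
  then have "integral\<^sup>L (\<sigma> k) F = 0" using \<open>\<omega> ^ m \<noteq> 1\<close> by simp
  then show ?thesis using False by (simp add: F_def set_lebesgue_integral_def)
qed

text \<open>The power of \<open>z\<close> in the density stems from
  \<open>1 / (z - t) = (\<Sum>i\<le>p. z ^ (p - i) * t ^ i) / (z ^ (p + 1) - t ^ (p + 1))\<close>: integration over \<open>t\<close>
  leaves only one term of the sum.\<close>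

definition wt :: "nat \<Rightarrow> nat \<Rightarrow> nat" where
  "wt k j = (if k < j then p + 1 - (j - k) else 0)"

lemma nikishin_density_eq:
  assumes "k \<le> j" "j < p" "z \<in> \<Gamma> k"
  shows "nikishin_density \<Gamma> \<sigma> k j z = z ^ wt k j * complex_of_real (h k j (rp z))"
  using assms
proof (induction "j - k" arbitrary: k z)
  case 0
  then show ?case by (simp add: nikishin_density.simps wt_def)
next
  case (Suc n)
  then have kj: "k < j" "k + 1 < p" "k + 1 \<le> j" by auto
  note z = \<open>z \<in> \<Gamma> k\<close>
  let ?M = "\<sigma> (k + 1)" and ?G = "\<Gamma> (k + 1)"
  define g where "g = (\<lambda>y. h (k + 1) j y / (rp z - y))"
  have ne: "rp z - y \<noteq> 0" if "y \<in> I (k + 1)" for y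
    using disjoint[OF kj(2)] that z by (auto simp: in_\<Gamma>_iff)
  have g: "continuous_on (I (k + 1)) g"
    unfolding g_def using kj \<open>j < p\<close> ne by (intro continuous_intros continuous_on_h) auto
  have kernel: "1 / (z - t) * nikishin_density \<Gamma> \<sigma> (k + 1) j t =
      (\<Sum>i<p + 1. z ^ (p - i) * (t ^ (i + wt (k + 1) j) * complex_of_real (g (rp t))))"
    if t: "t \<in> ?G" for t
  proof -
    have "z \<noteq> t" using \<Gamma>_disjoint[OF kj(2)] z t by blast
    moreover have "z ^ (p + 1) - t ^ (p + 1) = complex_of_real (rp z - rp t)"
      using z t unfolding in_\<Gamma>_iff by simp
    moreover have "rp z - rp t \<noteq> 0" using ne t by (simp add: in_\<Gamma>_iff)
    moreover have "t ^ (p + 1) - z ^ (p + 1) = (t - z) * (\<Sum>i<p + 1. z ^ (p - i) * t ^ i)"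
      using power_diff_sumr2[of t "p + 1" z] by simp
    ultimately have "1 / (z - t) = (\<Sum>i<p + 1. z ^ (p - i) * t ^ i) / complex_of_real (rp z - rp t)"
      by (simp add: field_simps del: of_real_diff)
    moreover have "nikishin_density \<Gamma> \<sigma> (k + 1) j t =
        t ^ wt (k + 1) j * complex_of_real (h (k + 1) j (rp t))"
      using Suc.hyps(2) kj \<open>j < p\<close> t by (intro Suc.hyps(1)) auto
    ultimately show ?thesis
      unfolding sum_divide_distrib sum_distrib_right
      by (simp only: sum_distrib_right) (intro sum.cong refl, simp add: g_def power_add)
  qed
  have int: "set_integrable ?M ?G (\<lambda>t. t ^ m * complex_of_real (g (rp t)))" for m
    by (intro set_integrable_continuous_compact finite_\<sigma> sets_\<sigma> kj compact_\<Gamma>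
        continuous_intros continuous_on_compose2[OF g]) (auto simp: in_\<Gamma>_iff)
  \<comment> \<open>The only \<open>i \<le> p\<close> for which \<open>i + wt (k + 1) j\<close> is a
    multiple of \<open>p + 1\<close>, hence the only term that survives integration. Its companion
    power \<open>p - i0\<close> of \<open>z\<close> is \<open>wt k j\<close>.\<close>
  define i0 where "i0 = j - (k + 1)"
  have dvd: "(p + 1) dvd (i + wt (k + 1) j) \<longleftrightarrow> i = i0" if "i < p + 1" for i
  proof (cases "k + 1 < j")
    case False
    then show ?thesis using kj(3) that by (auto simp: wt_def i0_def dest: dvd_imp_le)
  next
    case True
    then have eq: "i + wt (k + 1) j + i0 = i + (p + 1)" "i0 < p + 1"
      using \<open>j < p\<close> by (auto simp: wt_def i0_def)
    show ?thesis
    proof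
      assume "(p + 1) dvd (i + wt (k + 1) j)"
      then have "(i + wt (k + 1) j + i0) mod (p + 1) = i0 mod (p + 1)"
        by (metis add.commute add_0_right dvd_eq_mod_eq_0 mod_add_right_eq)
      then show "i = i0" by (metis eq mod_add_self2 mod_less that)
    next
      assume "i = i0"
      then show "(p + 1) dvd (i + wt (k + 1) j)" using eq(1) by (metis add.commute add_left_cancel dvd_refl)
    qed
  qed
  have i0: "i0 < p + 1" using \<open>j < p\<close> by (simp add: i0_def)
  \<comment> \<open>The total power of \<open>t\<close> is \<open>p + 1\<close> for
    \<open>k + 1 < j\<close> and 0 for \<open>j = k + 1\<close>, which explains the case distinction
    in \<open>interval_density\<close>.\<close>
  have quot: "x ^ ((i0 + wt (k + 1) j) div (p + 1)) = (if k + 1 < j then x else 1)" for x :: real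
    using \<open>j < p\<close> kj by (auto simp: i0_def wt_def)
  have "nikishin_density \<Gamma> \<sigma> k j z =
      (LINT t:?G|?M. 1 / (z - t) * nikishin_density \<Gamma> \<sigma> (k + 1) j t)"
    using kj by (subst nikishin_density.simps) simp
  also have "\<dots> = (LINT t:?G|?M. \<Sum>i<p + 1. z ^ (p - i) * (t ^ (i + wt (k + 1) j) * complex_of_real (g (rp t))))"
    using kernel borel_\<Gamma> sets_\<sigma>[OF kj(2)] by (intro set_lebesgue_integral_cong) simp_all
  also have "\<dots> = (\<Sum>i<p + 1. z ^ (p - i) * (LINT t:?G|?M. t ^ (i + wt (k + 1) j) * complex_of_real (g (rp t))))"
    unfolding set_lebesgue_integral_def scaleR_sum_right
    using int by (subst Bochner_Integration.integral_sum)
      (auto simp: set_integrable_def mult_scaleR_right[symmetric] simp del: mult_scaleR_right)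
  also have "\<dots> = (\<Sum>i<p + 1. if i = i0 then z ^ (p - i0) * complex_of_real
      (LINT x:I (k + 1)|\<tau> (k + 1). x ^ ((i0 + wt (k + 1) j) div (p + 1)) * g x) else 0)"
    by (intro sum.cong refl) (simp only: star_integral[OF kj(2) g] lessThan_iff dvd, simp)
  also have "\<dots> = z ^ (p - i0) * complex_of_real
      (LINT x:I (k + 1)|\<tau> (k + 1). x ^ ((i0 + wt (k + 1) j) div (p + 1)) * g x)"
    using i0 by simp
  also have "(LINT x:I (k + 1)|\<tau> (k + 1). x ^ ((i0 + wt (k + 1) j) div (p + 1)) * g x) = h k j (rp z)"
    unfolding quot h_less[OF kj(1)] g_def by simp
  also have "p - i0 = wt k j" using kj \<open>j < p\<close> by (simp add: i0_def wt_def)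
  finally show ?case .
qed

section \<open>Normality and the recurrence\<close>

text \<open>The integral of \<open>z ^ i * z ^ (m div p)\<close> against the measure of index
  \<open>m mod p\<close>, evaluated through \<open>nikishin_density_eq\<close> and
  \<open>star_integral\<close>; hence a real number.\<close>

definition moment :: "nat \<Rightarrow> nat \<Rightarrow> real" where
  "moment m i = (let j = m mod p; n = i + m div p + wt 0 j in
     if (p + 1) dvd n then LINT x:I 0|\<tau> 0. x ^ (n div (p + 1)) * h 0 j x else 0)"

definition condition :: "nat \<Rightarrow> complex poly \<Rightarrow> complex" where
  "condition m q = nikishin_integral \<Gamma> \<sigma> 0 (m mod p) (\<lambda>z. poly q z * z ^ (m div p))"

text \<open>The summation bound may exceed the degree, so that polynomials of different degrees can
  be compared termwise.\<close>

lemma condition_eq: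
  assumes "degree q \<le> n"
  shows "condition m q = (\<Sum>i\<le>n. coeff q i * complex_of_real (moment m i))"
proof -
  let ?j = "m mod p" and ?l = "m div p"
  have j: "?j < p" "0 < p" using p by auto
  have h: "continuous_on (I 0) (h 0 ?j)" by (rule continuous_on_h) (use j in auto)
  define F where "F = (\<lambda>i z. z ^ (i + ?l + wt 0 ?j) * complex_of_real (h 0 ?j (rp z)))"
  have int: "set_integrable (\<sigma> 0) (\<Gamma> 0) (F i)" for i
    unfolding F_def by (intro set_integrable_continuous_compact finite_\<sigma> sets_\<sigma> j compact_\<Gamma>
        continuous_intros continuous_on_compose2[OF h]) (auto simp: in_\<Gamma>_iff)
  have "condition m q = (LINT z:\<Gamma> 0|\<sigma> 0. \<Sum>i\<le>n. coeff q i * F i z)"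
    unfolding condition_def nikishin_integral_def
  proof (rule set_lebesgue_integral_cong)
    show "\<Gamma> 0 \<in> sets (\<sigma> 0)" using borel_\<Gamma> sets_\<sigma>[OF j(2)] by simp
    have "poly q z * z ^ ?l * nikishin_density \<Gamma> \<sigma> 0 ?j z = (\<Sum>i\<le>n. coeff q i * F i z)"
      if "z \<in> \<Gamma> 0" for z
    proof -
      have "poly q z = (\<Sum>i\<le>n. coeff q i * z ^ i)"
        using arg_cong[OF poly_as_sum_of_monoms'[OF assms], of "\<lambda>q. poly q z"]
        by (simp add: poly_sum poly_monom)
      then show ?thesis
        unfolding nikishin_density_eq[OF le0 j(1) that] F_def
        by (simp add: sum_distrib_left sum_distrib_right power_add mult_ac)
    qed
    then show "\<forall>z. z \<in> \<Gamma> 0 \<longrightarrow> poly q z * z ^ ?l * nikishin_density \<Gamma> \<sigma> 0 ?j z = (\<Sum>i\<le>n. coeff q i * F i z)"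
      by blast
  qed
  also have "\<dots> = (\<integral>z. (\<Sum>i\<le>n. coeff q i * (indicator (\<Gamma> 0) z *\<^sub>R F i z)) \<partial>\<sigma> 0)"
    unfolding set_lebesgue_integral_def
    by (intro Bochner_Integration.integral_cong refl) (simp add: scaleR_sum_right)
  also have "\<dots> = (\<Sum>i\<le>n. \<integral>z. coeff q i * (indicator (\<Gamma> 0) z *\<^sub>R F i z) \<partial>\<sigma> 0)"
    using int by (intro Bochner_Integration.integral_sum integrable_mult_right) (simp only: set_integrable_def)
  also have "\<dots> = (\<Sum>i\<le>n. coeff q i * (LINT z:\<Gamma> 0|\<sigma> 0. F i z))"
    by (simp only: set_lebesgue_integral_def integral_mult_right_zero)
  also have "\<dots> = (\<Sum>i\<le>n. coeff q i * complex_of_real (moment m i))"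
    unfolding F_def star_integral[OF j(2) h] by (simp only: moment_def Let_def)
  finally show ?thesis .
qed

lemma condition_diff: "condition m (q - r) = condition m q - condition m r"
proof -
  let ?n = "max (degree q) (degree r)"
  have "degree (q - r) \<le> ?n" by (rule degree_diff_le) auto
  then show ?thesis
    unfolding condition_eq[OF max.cobounded1[of "degree q" "degree r"]]
      condition_eq[OF max.cobounded2[of "degree r" "degree q"]]
    by (simp add: condition_eq sum_subtractf left_diff_distrib)
qed

lemma condition_smult: "condition m (smult c q) = c * condition m q"
  using condition_eq[of q "degree q" m] condition_eq[OF degree_smult_le[of c q], of m]
  by (simp add: sum_distrib_left mult_ac)

lemma condition_shift: "condition m (pCons 0 q) = condition (m + p) q"
  using p by (simp add: condition_def mult_ac)

text \<open>Modulo \<open>p + 1\<close>, \<open>p\<close> is -1 and \<open>wt 0 j\<close> is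
  \<open>- j\<close>. With \<open>m = l * p + j\<close> the exponent \<open>i + l + wt 0 j\<close>
  is therefore congruent to \<open>i - m\<close>.\<close>

lemma moment_eq_0:
  assumes "i mod (p + 1) \<noteq> m mod (p + 1)"
  shows "moment m i = 0"
proof -
  let ?j = "m mod p" and ?l = "m div p"
  have j: "?j < p" using p by simp
  have "\<not> (p + 1) dvd (i + ?l + wt 0 ?j)"
  proof
    assume "(p + 1) dvd (i + ?l + wt 0 ?j)"
    then obtain k where k: "i + ?l + wt 0 ?j = (p + 1) * k" by blast
    have "\<exists>s. ?j + wt 0 ?j = (p + 1) * s"
      using j by (cases "?j = 0") (auto simp: wt_def intro: exI[of _ 1])
    then obtain s where s: "?j + wt 0 ?j = (p + 1) * s" by blast
    have "u + (p + 1) * k = i + (p + 1) * (l + s)"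
      if "u = l * p + j" "i + l + w = (p + 1) * k" "j + w = (p + 1) * s" for u l j w
      using that by (simp add: algebra_simps)
    from this[OF div_mult_mod_eq[symmetric] k s]
    have "m + (p + 1) * k = i + (p + 1) * (?l + s)" .
    then have "(m + (p + 1) * k) mod (p + 1) = (i + (p + 1) * (?l + s)) mod (p + 1)" by simp
    then show False using assms by (simp only: mod_mult_self2)
  qed
  then show ?thesis by (simp only: moment_def Let_def if_False)
qed

text \<open>The row index equals \<open>(r + t) + p * t\<close>, so it has the residue of
  \<open>r + t\<close> modulo \<open>p\<close> and a quotient larger by \<open>t\<close>.\<close>

lemma moment_eq:
  "moment (r + (p + 1) * t) (r + (p + 1) * s) = (LINT x:I 0|\<tau> 0. x ^ s * \<phi> (r + t) x)"
proof -
  let ?m = "r + (p + 1) * t" and ?j = "(r + t) mod p" and ?w = "(r + t) div p"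
  have m: "?m = (r + t) + p * t" by simp
  have "?m div p = ?w + t" "?m mod p = ?j" unfolding m using p by simp_all
  moreover have "?j < p" using p by simp
  moreover have "r + (p + 1) * s + (?w + t) + wt 0 ?j =
      (p + 1) * (s + (?w + (if ?j = 0 then 0 else 1)))"
  proof -
    have "r + (p + 1) * s + (w + t) + wt 0 j = (p + 1) * (s + (w + (if j = 0 then 0 else 1)))"
      if "p * w + j = r + t" "j < p" for w j
      using that by (auto simp: wt_def algebra_simps)
    from this[OF mult_div_mod_eq \<open>?j < p\<close>] show ?thesis .
  qed
  ultimately show ?thesis
    unfolding moment_def Let_def \<phi>_def
    by (simp only: dvd_triv_left if_True nonzero_mult_div_cancel_left power_add mult.assoc)
qed

lemma sum_residue_class:
  fixes f :: "nat \<Rightarrow> 'a::comm_monoid_add"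
  assumes d: "\<And>s. s < d \<longleftrightarrow> r + (p + 1) * s < n" and r: "r \<le> p"
    and f: "\<And>i. i mod (p + 1) \<noteq> r \<Longrightarrow> f i = 0"
  shows "(\<Sum>i<n. f i) = (\<Sum>s<d. f (r + (p + 1) * s))"
proof -
  have "(\<Sum>i<n. f i) = (\<Sum>i\<in>(\<lambda>s. r + (p + 1) * s) ` {..<d}. f i)"
  proof (rule sum.mono_neutral_right)
    show "\<forall>i\<in>{..<n} - (\<lambda>s. r + (p + 1) * s) ` {..<d}. f i = 0"
    proof (intro ballI f notI)
      fix i assume i: "i \<in> {..<n} - (\<lambda>s. r + (p + 1) * s) ` {..<d}" "i mod (p + 1) = r"
      then have eq: "i = r + (p + 1) * (i div (p + 1))" using mod_mult_div_eq[of i "p + 1"] by simp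
      then have "i div (p + 1) < d" using i(1) d[of "i div (p + 1)"] by simp
      then show False using i(1) eq by blast
    qed
  qed (use d in auto)
  also have "\<dots> = (\<Sum>s<d. f (r + (p + 1) * s))"
    by (subst sum.reindex) (auto simp: inj_on_def simp del: mult_Suc)
  finally show ?thesis .
qed

text \<open>Normality. For each residue \<open>r\<close>, the conditions and the coefficients with
  index \<open>r + (p + 1) * s < n\<close> form a square system whose matrix is a real moment matrix
  with trivial kernel.\<close>

lemma conditions_imp_zero:
  assumes deg: "\<And>i. n \<le> i \<Longrightarrow> coeff q i = 0" and cond: "\<And>m. m < n \<Longrightarrow> condition m q = 0"
  shows "q = 0"
proof -
  have sum0: "(\<Sum>i<n. coeff q i * complex_of_real (moment m i)) = 0" if m: "m < n" for m
  proof -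
    have "degree q \<le> n" by (rule degree_le) (use deg in auto)
    then have "0 = (\<Sum>i\<le>n. coeff q i * complex_of_real (moment m i))"
      using cond[OF m] condition_eq by metis
    also have "{..n} = insert n {..<n}" by auto
    finally show ?thesis using deg[of n] by simp
  qed
  have "coeff q i = 0" if "i < n" for i
  proof -
    define r where "r = i mod (p + 1)"
    \<comment> \<open>The quotient \<open>(n - r) / (p + 1)\<close> rounded up: the number of
      indices below \<open>n\<close> congruent to \<open>r\<close>.\<close>
    define d where "d = (n - r + p) div (p + 1)"
    have r: "r \<le> p" "r < n"
      using that le_less_trans[OF mod_less_eq_dividend[of i "p + 1"]] mod_less_divisor[of "p + 1" i]
      by (auto simp: r_def)
    have d: "s < d \<longleftrightarrow> r + (p + 1) * s < n" for s
    proof -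
      have "s < d \<longleftrightarrow> Suc s * (p + 1) \<le> n - r + p"
        unfolding d_def Suc_le_eq[symmetric] by (rule less_eq_div_iff_mult_less_eq) simp
      then show ?thesis using r by (auto simp: algebra_simps)
    qed
    define c where "c = (\<lambda>s. coeff q (r + (p + 1) * s))"
    have c: "(\<Sum>s<d. complex_of_real (LINT x:I 0|\<tau> 0. x ^ s * \<phi> (r + t) x) * c s) = 0" if t: "t < d" for t
    proof -
      let ?m = "r + (p + 1) * t"
      have "?m mod (p + 1) = r" using r by (simp only: mod_mult_self2) simp
      then have "(\<Sum>i<n. coeff q i * complex_of_real (moment ?m i)) =
          (\<Sum>s<d. coeff q (r + (p + 1) * s) * complex_of_real (moment ?m (r + (p + 1) * s)))"
        by (intro sum_residue_class d r) (simp only: moment_eq_0 of_real_0 mult_zero_right not_False_eq_True)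
      then show ?thesis
        using sum0[of ?m] d t unfolding moment_eq by (simp add: c_def mult.commute)
    qed
    \<comment> \<open>The matrix is real while the coefficients are complex, so real and imaginary
      parts are treated separately.\<close>
    have "\<forall>s<d. Re (c s) = 0"
    proof (rule moment_matrix_right_kernel)
      show "\<forall>t<d. (\<Sum>s<d. (LINT x:I 0|\<tau> 0. x ^ s * \<phi> (r + t) x) * Re (c s)) = 0"
        using arg_cong[OF c, of _ Re] by (simp add: Re_sum)
    qed (use p r(1) in auto)
    moreover have "\<forall>s<d. Im (c s) = 0"
    proof (rule moment_matrix_right_kernel)
      show "\<forall>t<d. (\<Sum>s<d. (LINT x:I 0|\<tau> 0. x ^ s * \<phi> (r + t) x) * Im (c s)) = 0"
        using arg_cong[OF c, of _ Im] by (simp add: Im_sum)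
    qed (use p r(1) in auto)
    moreover have i: "i = r + (p + 1) * (i div (p + 1))" unfolding r_def by (rule mod_mult_div_eq[symmetric])
    moreover from this have "i div (p + 1) < d" using d \<open>i < n\<close> by simp
    ultimately have "c (i div (p + 1)) = 0" by (simp add: complex_eq_iff)
    then show ?thesis using i by (simp add: c_def)
  qed
  then show ?thesis using deg by (intro poly_eqI) (metis coeff_0 not_le)
qed

section \<open>Existence, uniqueness and symmetry of the orthogonal polynomials\<close>

text \<open>The floor bound on \<open>l\<close> unfolds to \<open>l * p + j < n\<close>, and
  division by \<open>p\<close> matches the pairs \<open>(l, j)\<close> with the numbers
  \<open>m < n\<close>.\<close>

lemma multi_orthogonal_iff:
  "multi_orthogonal p \<Gamma> \<sigma> n q \<longleftrightarrow> (\<forall>m<n. condition m q = 0)"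
proof -
  have bound: "int l \<le> (int n - int j - 1) div int p \<longleftrightarrow> l * p + j < n" for l j
  proof -
    define D where "D = int n - int j - 1"
    have D: "D div int p * int p \<le> D" "D < (D div int p + 1) * int p"
    proof -
      have "D div int p * int p + D mod int p = D" by (rule div_mult_mod_eq)
      moreover have "0 \<le> D mod int p" "D mod int p < int p" using p by simp_all
      moreover have "(D div int p + 1) * int p = D div int p * int p + int p" by (simp add: distrib_right)
      ultimately show "D div int p * int p \<le> D" "D < (D div int p + 1) * int p" by linarith+
    qed
    have "int l \<le> D div int p \<longleftrightarrow> int l * int p \<le> D"
    proof
      assume "int l \<le> D div int p"
      then have "int l * int p \<le> D div int p * int p" by (rule mult_right_mono) simp
      then show "int l * int p \<le> D" using D(1) by linarith
    next
      assume "int l * int p \<le> D"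
      then have "int l * int p < (D div int p + 1) * int p" using D(2) by linarith
      then have "int l < D div int p + 1" by (rule mult_right_less_imp_less) simp
      then show "int l \<le> D div int p" by simp
    qed
    then have "int l \<le> (int n - int j - 1) div int p \<longleftrightarrow> int l * int p \<le> int n - int j - 1"
      by (simp only: D_def)
    also have "\<dots> \<longleftrightarrow> int (l * p + j) < int n" by auto
    finally show ?thesis by (simp only: of_nat_less_iff)
  qed
  show ?thesis
  proof
    assume "multi_orthogonal p \<Gamma> \<sigma> n q"
    then show "\<forall>m<n. condition m q = 0"
      unfolding multi_orthogonal_def bound condition_def using p by simp
  next
    assume *: "\<forall>m<n. condition m q = 0"
    show "multi_orthogonal p \<Gamma> \<sigma> n q"
      unfolding multi_orthogonal_def bound
    proof (intro allI impI)
      fix j l assume j: "j < p" and l: "l * p + j < n"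
      have "(l * p + j) mod p = j" "(l * p + j) div p = l" using j by simp_all
      then show "nikishin_integral \<Gamma> \<sigma> 0 j (\<lambda>z. poly q z * z ^ l) = 0"
        using *[rule_format, OF l] by (simp only: condition_def)
    qed
  qed
qed

text \<open>Normality excludes monic solutions of degree below \<open>n\<close>, and it makes the
  difference of two monic solutions of degree \<open>n\<close> vanish.\<close>

lemma multi_orthogonal_poly_eqI:
  assumes q: "lead_coeff q = 1" "degree q = n" "\<And>m. m < n \<Longrightarrow> condition m q = 0"
  shows "multi_orthogonal_poly p \<Gamma> \<sigma> n = q"
proof -
  have min: "n \<le> degree r" if "lead_coeff r = 1" "multi_orthogonal p \<Gamma> \<sigma> n r" for r
  proof (rule ccontr)
    assume "\<not> n \<le> degree r"
    then have "r = 0"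
      using that(2) by (intro conditions_imp_zero[of n]) (auto simp: multi_orthogonal_iff intro: coeff_eq_0)
    then show False using that(1) by simp
  qed
  show ?thesis
    unfolding multi_orthogonal_poly_def
  proof (rule the_equality)
    show "lead_coeff q = 1 \<and> multi_orthogonal p \<Gamma> \<sigma> n q \<and>
        (\<forall>r. lead_coeff r = 1 \<and> multi_orthogonal p \<Gamma> \<sigma> n r \<longrightarrow> degree q \<le> degree r)"
      using q min by (simp add: multi_orthogonal_iff)
  next
    fix r assume r: "lead_coeff r = 1 \<and> multi_orthogonal p \<Gamma> \<sigma> n r \<and>
        (\<forall>s. lead_coeff s = 1 \<and> multi_orthogonal p \<Gamma> \<sigma> n s \<longrightarrow> degree r \<le> degree s)"
    then have "degree r = n" using q min[of r] by (force simp: multi_orthogonal_iff)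
    have "r - q = 0"
    proof (rule conditions_imp_zero)
      show "condition m (r - q) = 0" if "m < n" for m
        using r q(3)[OF that] that by (simp add: condition_diff multi_orthogonal_iff)
      show "coeff (r - q) i = 0" if "n \<le> i" for i
        using that r q \<open>degree r = n\<close> by (cases "i = n") (auto simp: coeff_eq_0)
    qed
    then show "r = q" by simp
  qed
qed

text \<open>The symmetric real polynomial below arises as a kernel vector of the moment matrix of one
  residue class, which has one more column than rows.\<close>

lemma multi_orthogonal_poly_props:
  shows "lead_coeff (multi_orthogonal_poly p \<Gamma> \<sigma> n) = 1"
    and "degree (multi_orthogonal_poly p \<Gamma> \<sigma> n) = n"
    and "m < n \<Longrightarrow> condition m (multi_orthogonal_poly p \<Gamma> \<sigma> n) = 0"
    and "i mod (p + 1) \<noteq> n mod (p + 1) \<Longrightarrow> coeff (multi_orthogonal_poly p \<Gamma> \<sigma> n) i = 0"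
    and "coeff (multi_orthogonal_poly p \<Gamma> \<sigma> n) i \<in> \<real>"
proof -
  define r d where "r = n mod (p + 1)" and "d = n div (p + 1)"
  have r: "r \<le> p" unfolding r_def using mod_less_divisor[of "p + 1" n] by simp
  have n: "n = r + (p + 1) * d" unfolding r_def d_def by (rule mod_mult_div_eq[symmetric])
  have "card {..<d} < card {..d}" by simp
  from underdetermined_system[OF _ _ this, of "\<lambda>t s. LINT x:I 0|\<tau> 0. x ^ s * \<phi> (r + t) x"]
  obtain c where c: "\<exists>s\<le>d. c s \<noteq> 0"
    "\<forall>t<d. (\<Sum>s\<le>d. (LINT x:I 0|\<tau> 0. x ^ s * \<phi> (r + t) x) * c s) = 0" by auto
  define q where "q = (\<Sum>s\<le>d. monom (complex_of_real (c s)) (r + (p + 1) * s))"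
  have coeff_q: "coeff q i = (\<Sum>s\<le>d. if r + (p + 1) * s = i then complex_of_real (c s) else 0)" for i
    by (simp add: q_def coeff_sum)
  have coeff_class: "coeff q (r + (p + 1) * s) = (if s \<le> d then complex_of_real (c s) else 0)" for s
    unfolding coeff_q by (simp add: sum.delta' del: mult_Suc)
  have coeff_other: "coeff q i = 0" if "i mod (p + 1) \<noteq> r" for i
    unfolding coeff_q using that r by (intro sum.neutral) (auto simp del: mult_Suc)
  have coeff_big: "coeff q i = 0" if "n < i" for i
    unfolding coeff_q using that n
    by (intro sum.neutral ballI) (metis add_le_cancel_left atMost_iff mult_le_mono2 not_le)
  have cond: "condition m q = 0" if m: "m < n" for m
  proof -
    have deg: "degree q \<le> n" by (rule degree_le) (use coeff_big in auto)
    show ?thesis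
    proof (cases "m mod (p + 1) = r")
      case True
      define t where "t = m div (p + 1)"
      have mt: "m = r + (p + 1) * t" unfolding t_def True[symmetric] by (rule mod_mult_div_eq[symmetric])
      then have t: "t < d" using m n by (simp del: mult_Suc)
      have "condition m q = (\<Sum>i<Suc n. coeff q i * complex_of_real (moment m i))"
        unfolding condition_eq[OF deg] lessThan_Suc_atMost ..
      also have "\<dots> = (\<Sum>s<Suc d. coeff q (r + (p + 1) * s) * complex_of_real (moment m (r + (p + 1) * s)))"
      proof (rule sum_residue_class[OF _ r])
        show "s < Suc d \<longleftrightarrow> r + (p + 1) * s < Suc n" for s
          unfolding n less_Suc_eq_le by (simp del: mult_Suc)
        show "coeff q i * complex_of_real (moment m i) = 0" if "i mod (p + 1) \<noteq> r" for i
          using coeff_other[OF that] by simp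
      qed
      also have "\<dots> = (\<Sum>s\<le>d. complex_of_real (c s) * complex_of_real (LINT x:I 0|\<tau> 0. x ^ s * \<phi> (r + t) x))"
        unfolding lessThan_Suc_atMost mt moment_eq coeff_class by (intro sum.cong) auto
      also have "\<dots> = complex_of_real (\<Sum>s\<le>d. (LINT x:I 0|\<tau> 0. x ^ s * \<phi> (r + t) x) * c s)"
        by (simp add: mult.commute)
      also have "\<dots> = 0" using c(2) t by simp
      finally show ?thesis .
    next
      case False
      have "coeff q i * complex_of_real (moment m i) = 0" for i
        using coeff_other[of i] moment_eq_0[of i m] False by (cases "i mod (p + 1) = r") auto
      then show ?thesis unfolding condition_eq[OF deg] by (intro sum.neutral ballI)
    qed
  qed
  \<comment> \<open>Otherwise \<open>q\<close> has no coefficient from index \<open>n\<close> on and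
    satisfies \<open>n\<close> conditions, so normality makes it zero although \<open>c\<close> is a
    nontrivial vector.\<close>
  have "c d \<noteq> 0"
  proof
    assume "c d = 0"
    then have "coeff q n = 0" unfolding n coeff_class by simp
    then have "q = 0"
      using coeff_big cond by (intro conditions_imp_zero[of n]) (auto simp: le_less)
    then have "c s = 0" if "s \<le> d" for s using coeff_class[of s] that by simp
    then show False using c(1) by blast
  qed
  define Q where "Q = smult (1 / complex_of_real (c d)) q"
  have coeff_Q: "coeff Q i = coeff q i / complex_of_real (c d)" for i by (simp add: Q_def)
  have Qn: "coeff Q n = 1" unfolding coeff_Q n coeff_class using \<open>c d \<noteq> 0\<close> by simp
  have deg: "degree Q = n"
  proof (rule antisym)
    show "degree Q \<le> n" by (rule degree_le) (simp add: coeff_Q coeff_big)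
    show "n \<le> degree Q" by (rule le_degree) (simp add: Qn)
  qed
  have lead: "lead_coeff Q = 1" by (simp only: deg Qn)
  have condQ: "condition m Q = 0" if "m < n" for m
    by (simp only: Q_def condition_smult cond[OF that] mult_zero_right)
  have eq: "multi_orthogonal_poly p \<Gamma> \<sigma> n = Q"
    by (rule multi_orthogonal_poly_eqI[OF lead deg condQ])
  show "lead_coeff (multi_orthogonal_poly p \<Gamma> \<sigma> n) = 1" unfolding eq by (rule lead)
  show "degree (multi_orthogonal_poly p \<Gamma> \<sigma> n) = n" unfolding eq by (rule deg)
  show "m < n \<Longrightarrow> condition m (multi_orthogonal_poly p \<Gamma> \<sigma> n) = 0" unfolding eq by (rule condQ)
  show "i mod (p + 1) \<noteq> n mod (p + 1) \<Longrightarrow> coeff (multi_orthogonal_poly p \<Gamma> \<sigma> n) i = 0"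
    unfolding eq coeff_Q r_def[symmetric] using coeff_other[of i] by simp
  have "coeff q i \<in> \<real>" unfolding coeff_q by (intro sum_in_Reals) auto
  then show "coeff (multi_orthogonal_poly p \<Gamma> \<sigma> n) i \<in> \<real>" unfolding eq coeff_Q by (intro Reals_divide) auto
qed

section \<open>The initial polynomials and the recurrence\<close>

lemma condition_in_Reals:
  assumes "\<And>i. coeff q i \<in> \<real>" shows "condition m q \<in> \<real>"
  unfolding condition_eq[OF order_refl] by (intro sum_in_Reals Reals_mult assms Reals_of_real)

lemma condition_eq_0_of_residue:
  assumes "\<And>i. i mod (p + 1) = m mod (p + 1) \<Longrightarrow> coeff q i = 0"
  shows "condition m q = 0"
proof -
  have "coeff q i * complex_of_real (moment m i) = 0" for i
    using assms[of i] moment_eq_0[of i m] by (cases "i mod (p + 1) = m mod (p + 1)") auto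
  then show ?thesis unfolding condition_eq[OF order_refl] by (intro sum.neutral ballI)
qed

text \<open>For \<open>m < l \<le> p\<close> the residues of \<open>m\<close> and \<open>l\<close>
  modulo \<open>p + 1\<close> differ, so the monomial meets every condition by symmetry
  alone.\<close>

lemma multi_orthogonal_poly_monom:
  assumes "l \<le> p" shows "multi_orthogonal_poly p \<Gamma> \<sigma> l = monom 1 l"
proof (rule multi_orthogonal_poly_eqI)
  show "condition m (monom 1 l) = 0" if "m < l" for m
    by (rule condition_eq_0_of_residue) (use that assms in auto)
qed (simp_all add: degree_monom_eq)

lemma multi_orthogonal_poly_recurrence:
  assumes n: "p \<le> n"
  obtains \<alpha> :: real where
    "pCons 0 (multi_orthogonal_poly p \<Gamma> \<sigma> n) =
      multi_orthogonal_poly p \<Gamma> \<sigma> (n + 1) +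
      smult (complex_of_real \<alpha>) (multi_orthogonal_poly p \<Gamma> \<sigma> (n - p))"
proof -
  let ?Q = "multi_orthogonal_poly p \<Gamma> \<sigma>"
  note Q = multi_orthogonal_poly_props
  \<comment> \<open>The value that makes condition \<open>n - p\<close> hold for \<open>F\<close>,
    since multiplication by \<open>z\<close> turns it into condition \<open>n\<close> on
    \<open>?Q n\<close>.\<close>
  define \<beta> where "\<beta> = condition n (?Q n) / condition (n - p) (?Q (n - p))"
  have "\<beta> \<in> \<real>" unfolding \<beta>_def by (intro Reals_divide condition_in_Reals Q(5))
  then obtain \<alpha> where \<alpha>: "\<beta> = complex_of_real \<alpha>" by (auto elim: Reals_cases)
  \<comment> \<open>Were it zero, \<open>?Q (n - p)\<close> would satisfy one condition more than
    its degree, against normality.\<close>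
  have ne: "condition (n - p) (?Q (n - p)) \<noteq> 0"
  proof
    assume "condition (n - p) (?Q (n - p)) = 0"
    then have "?Q (n - p) = 0"
      using Q(2)[of "n - p"] Q(3)[where n = "n - p"] by (intro conditions_imp_zero[of "Suc (n - p)"])
        (auto simp: less_Suc_eq intro: coeff_eq_0)
    then show False using Q(1)[of "n - p"] by simp
  qed
  define F where "F = pCons 0 (?Q n) - ?Q (n + 1) - smult \<beta> (?Q (n - p))"
  have cond_F: "condition m F = condition (m + p) (?Q n) - condition m (?Q (n + 1)) - \<beta> * condition m (?Q (n - p))" for m
    by (simp only: F_def condition_diff condition_smult condition_shift)
  \<comment> \<open>All three terms of \<open>F\<close> live in the same residue class, because
    \<open>n - p\<close> and \<open>n + 1\<close> differ by \<open>p + 1\<close>.\<close>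
  have coeff_F: "coeff F i = 0" if i: "i mod (p + 1) \<noteq> (n + 1) mod (p + 1)" for i
  proof -
    have "(n - p) + (p + 1) = n + 1" using n by simp
    then have "(n - p) mod (p + 1) = (n + 1) mod (p + 1)" by (metis mod_add_self2)
    moreover have "coeff (pCons 0 (?Q n)) i = 0"
    proof (cases i)
      case (Suc k)
      then have "k mod (p + 1) \<noteq> n mod (p + 1)" using i by (metis Suc_eq_plus1 mod_add_left_eq)
      then show ?thesis using Suc Q(4)[of k n] by simp
    qed simp
    ultimately show ?thesis using Q(4)[of i "n + 1"] Q(4)[of i "n - p"] i by (simp add: F_def)
  qed
  have "F = 0"
  proof (rule conditions_imp_zero[of "n + 1"])
    fix i assume i: "n + 1 \<le> i"
    then obtain k where k: "i = Suc k" by (cases i) auto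
    \<comment> \<open>At index \<open>n + 1\<close> the two monic leading terms cancel; beyond it
      all three terms have no coefficients.\<close>
    show "coeff F i = 0"
    proof (cases "i = n + 1")
      case True
      then show ?thesis
        using Q(1)[of n] Q(1)[of "n + 1"] by (simp add: F_def Q(2) k coeff_eq_0)
    next
      case False
      then show ?thesis using i by (simp add: F_def k coeff_eq_0 Q(2))
    qed
  next
    fix m assume m: "m < n + 1"
    \<comment> \<open>Below \<open>n - p\<close> each term of \<open>F\<close> satisfies the
      condition by itself, at \<open>n - p\<close> the choice of \<beta> decides, and the remaining
      \<open>m \<le> n\<close> miss the residue of \<open>n + 1\<close>.\<close>
    consider "m < n - p" | "m = n - p" | "n - p < m" by linarith
    then show "condition m F = 0"
    proof cases
      case 1
      then show ?thesis unfolding cond_F using Q(3) n by simp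
    next
      case 2
      then show ?thesis unfolding cond_F using Q(3)[of m "n + 1"] n m ne by (simp add: \<beta>_def)
    next
      case 3
      have "m mod (p + 1) \<noteq> (n + 1) mod (p + 1)"
      proof
        assume "m mod (p + 1) = (n + 1) mod (p + 1)"
        then have "(p + 1) dvd (n + 1 - m)" using m by (metis less_imp_le mod_eq_dvd_iff_nat)
        then have "p + 1 \<le> n + 1 - m" using m by (intro dvd_imp_le) auto
        then show False using 3 m by simp
      qed
      then show ?thesis by (intro condition_eq_0_of_residue coeff_F) simp
    qed
  qed
  then show thesis by (intro that[of \<alpha>]) (simp add: F_def \<alpha> algebra_simps)
qed

end

theorem proposition3p1:
  fixes p :: nat
    and a b :: "nat \<Rightarrow> real"
    and \<Gamma> :: "nat \<Rightarrow> complex set"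
    and \<sigma> :: "nat \<Rightarrow> complex measure"
    and Q :: "nat \<Rightarrow> complex poly"
  assumes "p \<ge> 1"
    and "\<And>j. j < p \<Longrightarrow> even j \<Longrightarrow> 0 \<le> a j \<and> a j < b j"
    and "\<And>j. j < p \<Longrightarrow> odd j \<Longrightarrow> a j < b j \<and> b j \<le> 0"
    and "\<And>j. \<Gamma> j = star p (a j) (b j)"
    and "\<And>j. j + 1 < p \<Longrightarrow> \<Gamma> j \<inter> \<Gamma> (j + 1) = {}"
    and "\<And>j. j < p \<Longrightarrow> finite_measure (\<sigma> j)"
    and "\<And>j. j < p \<Longrightarrow> sets (\<sigma> j) = sets borel"
    and "\<And>j. j < p \<Longrightarrow> emeasure (\<sigma> j) (- \<Gamma> j) = 0"
    and "\<And>j. j < p \<Longrightarrow> distr (\<sigma> j) borel (\<lambda>z. cis (2 * pi / real (p + 1)) * z) = \<sigma> j"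
    and "\<And>j. j < p \<Longrightarrow> infinite (measure_support (\<sigma> j))"
    and "\<And>n. Q n = multi_orthogonal_poly p \<Gamma> \<sigma> n"
  shows "(\<forall>l\<le>p. Q l = monom 1 l) \<and>
    (\<exists>\<alpha> :: nat \<Rightarrow> real. \<forall>n\<ge>p. \<forall>z.
       z * poly (Q n) z = poly (Q (n + 1)) z + complex_of_real (\<alpha> n) * poly (Q (n - p)) z)"
proof -
  interpret star_nikishin p a b \<Gamma> \<sigma>
    by (rule star_nikishin.intro) (fact assms)+
  have "\<exists>\<alpha>. \<forall>z. z * poly (Q n) z = poly (Q (n + 1)) z + complex_of_real \<alpha> * poly (Q (n - p)) z"
    if n: "p \<le> n" for n
  proof -
    obtain \<alpha> where "pCons 0 (Q n) = Q (n + 1) + smult (complex_of_real \<alpha>) (Q (n - p))"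
      using multi_orthogonal_poly_recurrence[OF n] assms(11) by metis
    then have "poly (pCons 0 (Q n)) z = poly (Q (n + 1) + smult (complex_of_real \<alpha>) (Q (n - p))) z" for z
      by simp
    then show ?thesis by (intro exI[of _ \<alpha>]) simp
  qed
  then have "\<exists>\<alpha> :: nat \<Rightarrow> real. \<forall>n\<ge>p. \<forall>z.
      z * poly (Q n) z = poly (Q (n + 1)) z + complex_of_real (\<alpha> n) * poly (Q (n - p)) z"
    by metis
  then show ?thesis using multi_orthogonal_poly_monom assms(11) by simp
qed

end
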